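(* Consider the learning problem $F_\lambda=(\mathcal X_\lambda,\mathcal Y_\lambda,\mathcal D_\lambda,\mathcal H_\lambda)$ defined in the context. For computationally unbounded adversaries (of budget $(1-\sqrt R)n$ in Hamming distance over $\mathbb F_{2^\ell}$), any information-theoretic (computationally unbounded) learner with $\alpha/2$ parameters (i.e. outputting models with at most $\alpha/2$ bits of parameters) cannot $\varepsilon$-robustly learn $F_\lambda$ for $\varepsilon<1/3$.
   Context: **Learning.** A family of learning problems is $\{F_\lambda=(\mathcal X_\lambda,\mathcal Y_\lambda,\mathcal D_\lambda,\mathcal H_\lambda)\}_{\lambda\in\mathbb N}$, where $\mathcal H_\lambda$ is a set of functions $\mathcal X_\lambda\to\mathcal Y_\lambda$ and $\mathcal D_\lambda$ is a set of distributions supported on $\mathcal X_\lambda$; elements of $\mathcal X_\lambda,\mathcal Y_\lambda$ are represented with $\mathrm{poly}(\lambda)$ bits. A learner $L$ takes a labeled set $\mathcal S^h=\{(x,h(x)):x\in\mathcal S\}$ and $\lambda$, and outputs a function $f$ (not necessarily in $\mathcal H_\lambda$). For a metric $d$ and budget $r$, let $$\mathrm{Risk}_{d,r}(h,D,f)=\Pr_{x\leftarrow D}\big[\exists x':\ f(x')\neq h(x)\ \text{and}\ d(x,x')\le r\big].$$ For a function $\varepsilon(\cdot,\cdot)$, $L$ $\varepsilon$-robustly learns the family against (all) adversaries of budget $r$ with respect to $d$ if for all $\lambda\in\mathbb N$, $D_\lambda\in\mathcal D_\lambda$, $h\in\mathcal H_\lambda$ and all sample sizes $N\in\mathbb N$,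 $$\mathbf E_{\mathcal S\leftarrow D_\lambda^N,\ f\leftarrow L(\mathcal S^h,\lambda)}[\mathrm{Risk}_{d,r}(h,D_\lambda,f)]\le\varepsilon(\lambda,N).$$ $L$ outputs models with at most $p(\cdot)$ bits of parameters if $|\mathrm{Supp}(L(\cdot,\lambda))|\le 2^{p(\lambda)}$ for all $\lambda$, i.e. the set of possible outputs of $L(\cdot,\lambda)$ has size at most $2^{p(\lambda)}$. A function of $\lambda$ is negligible if for every polynomial $p$ it is smaller than $1/p(\lambda)$ for all sufficiently large $\lambda$. **Building blocks.** The parameters $n<\lambda<\alpha$ are given, with $n,\alpha$ polynomial in $\lambda$. The min-entropy of $X$ is $H_\infty(X)=-\log_2\max_\omega\Pr[X=\omega]$. $U_r$ is the uniform distribution on $\{0,1\}^r$. For a vector $x$ and a set $\mathcal S$ of coordinates, $x|_{\mathcal S}$ is the restriction of $x$ to $\mathcal S$. - $(\mathsf{Gen},\mathsf{Sign},\mathsf{Verify})$ is a signature scheme: the randomized algorithm $\mathsf{Gen}(1^\lambda)$ outputs a verification key and a signing key $(\mathsf{vk},\mathsf{sk})$; $\mathsf{Sign}(\mathsf{sk},m)$ outputs a signature $\sigma$; $\mathsf{Verify}(\mathsf{vk},m,\sigma)$ outputs a bit ($1$ meaning accept). Correctness: for every message $m$, $\Pr[\mathsf{Verify}(\mathsf{vk},m,\sigma)=1]=1$ for $(\mathsf{vk},\mathsf{sk})\leftarrow\mathsf{Gen}(1^\lambda)$, $\sigma=\mathsf{Sign}(\mathsf{sk},m)$. Weak unforgeability: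 for any probabilistic polynomial-time algorithm $B$ and message $m$, the probability that $m'\ne m$ and $\mathsf{Verify}(\mathsf{vk},m',\sigma')=1$, for $(\mathsf{vk},\mathsf{sk})\leftarrow\mathsf{Gen}(1^\lambda)$, $\sigma=\mathsf{Sign}(\mathsf{sk},m)$, $(m',\sigma')\leftarrow B(\mathsf{vk},m,\sigma)$, is negligible in $\lambda$. - $\mathrm{LEnc}:\mathbb F_{2^\ell}^k\to\mathbb F_{2^\ell}^n$ is the Reed–Solomon (RS) encoding over $\mathbb F_{2^\ell}$, for some $\ell=\Theta(\log\lambda)$: the message gives the coefficients of a polynomial of degree at most $k-1$, and the codeword is its list of values at $n$ fixed distinct field elements. The rate $R=k/n$ is any constant $<1/4$, and $k$ is determined by $R$ and $n$. - Sampler fact: for any $0<\kappa_1,\kappa_2<1$ and $M,t\in\mathbb N$ there is a deterministic sampler $\mathsf{samp}:\{0,1\}^r\to\binom{\{1,\dots,M\}}{t}$ (values are subsets of size $t$) with $r=\Theta(M^{\kappa_2})$ such that, if $X$ is a random variable over $\{0,1\}^M$ with min-entropy $\ge\mu M$, there is a random variable $Y$ over $\{0,1\}^t$ with min-entropy $\ge(\mu-\kappa_1)t$ such that the statistical distance between $(U_r,X|_{\mathsf{samp}(U_r)})$ and $(U_r,Y)$ is at most $\exp(-\Theta(M\kappa_1))+\exp(-M^{\kappa_2})$ (the two $U_r$ in the first pair are the same sample). Let $\mathsf{samp}:\{0,1\}^r\to\binom{\{1,\dots,\alpha\}}{n}$ be a sampler given by this fact with sufficiently small $\kappa_1$ and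 $\kappa_2$ (for instance, $\kappa_1=\Theta(1/\log\lambda)$ and $\kappa_2$ any small constant suffices). - For a binary string $v$, $[v]$ is an arbitrary error-correcting encoding of $v$ over $\mathbb F_{2^\ell}$ that can correct more than $(1-\sqrt R)n$ errors (e.g. an RS encoding of suitable rate). **The learning problem.** $\mathcal Y_\lambda=\{0,1\}$. $\mathcal D_\lambda=\{D_s:s\in\{0,1\}^\alpha\}$, where $D_s$ is the distribution of $$x=\big([u],\,[v],\,[\mathsf{vk}],\,\mathrm{LEnc}(b,\mathsf{Sign}(\mathsf{sk},b)),\,[\,b+\langle v,s|_{\mathsf{samp}(u)}\rangle\,]\big)$$ with $u$, $v$, $b$ sampled uniformly from $\{0,1\}^r$, $\{0,1\}^n$, $\{0,1\}$ respectively and $(\mathsf{vk},\mathsf{sk})\leftarrow\mathsf{Gen}(1^\lambda)$ (fresh for every instance); $(b,\mathsf{Sign}(\mathsf{sk},b))$ is interpreted as a vector in $\mathbb F_{2^\ell}^k$ in the natural way, and $b+\langle v,s|_{\mathsf{samp}(u)}\rangle$ is computed over $\mathbb F_2$. $\mathcal X_\lambda$ is the set of binary strings of the length implicitly defined by $\mathcal D_\lambda$. $\mathcal H_\lambda$ consists of the single function $h$ which, on input $x$, decodes $\mathrm{LEnc}(b,\mathsf{Sign}(\mathsf{sk},b))$ and outputs $b$. Adversary: the entire input $x$ is interpreted as a vector over $\mathbb F_{2^\ell}$, and the adversary may perturb at most $(1-\sqrt R)n$ symbols; that is, $d$ is Hamming distance over $\mathbb F_{2^\ell}$ and the budget is $(1-\sqrt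 R)n$. *)

theory Defs
  imports
    "HOL-Probability.Probability"
    "HOL-Computational_Algebra.Polynomial"
    "HOL-Library.Landau_Symbols"
    "HOL-Library.Monad_Syntax"
    "HOL-Algebra.Ring"
begin

text \<open>The security parameter is written \<open>\<eta>\<close> throughout, since \<open>\<lambda>\<close> is not a variable name.\<close>

section \<open>Robust learning\<close>

record ('x, 'y) problem =
  inputs :: "'x set"
  labels :: "'y set"
  dists :: "'x pmf set"
  hyps :: "('x \<Rightarrow> 'y) set"

text \<open>
  A learner sees the labelled sample as an ordered list, which is at least as informative as the
  set of its entries.
\<close>
type_synonym ('x, 'y) learner = "('x \<times> 'y) list \<Rightarrow> nat \<Rightarrow> ('x \<Rightarrow> 'y) pmf"

definition labelled :: "('x \<Rightarrow> 'y) \<Rightarrow> 'x list \<Rightarrow> ('x \<times> 'y) list" where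
  "labelled h S = map (\<lambda>x. (x, h x)) S"

definition risk ::
  "('x, 'y) problem \<Rightarrow> ('x \<Rightarrow> 'x \<Rightarrow> real) \<Rightarrow> real \<Rightarrow> ('x \<Rightarrow> 'y) \<Rightarrow> 'x pmf \<Rightarrow> ('x \<Rightarrow> 'y) \<Rightarrow> real" where
  "risk F d r h D f =
     measure_pmf.prob D {x. \<exists>x'\<in>inputs F. f x' \<noteq> h x \<and> d x x' \<le> r}"

definition expected_risk ::
  "('x, 'y) problem \<Rightarrow> ('x \<Rightarrow> 'x \<Rightarrow> real) \<Rightarrow> real \<Rightarrow> ('x, 'y) learner \<Rightarrow> nat \<Rightarrow>
   ('x \<Rightarrow> 'y) \<Rightarrow> 'x pmf \<Rightarrow> nat \<Rightarrow> real" where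
  "expected_risk F d r L \<eta> h D N =
     measure_pmf.expectation
       (do { S \<leftarrow> replicate_pmf N D; L (labelled h S) \<eta> })
       (\<lambda>f. risk F d r h D f)"

definition robustly_learns ::
  "(nat \<Rightarrow> ('x, 'y) problem) \<Rightarrow> (nat \<Rightarrow> 'x \<Rightarrow> 'x \<Rightarrow> real) \<Rightarrow> (nat \<Rightarrow> real) \<Rightarrow>
   (nat \<Rightarrow> nat \<Rightarrow> real) \<Rightarrow> ('x, 'y) learner \<Rightarrow> bool" where
  "robustly_learns F d r \<epsilon> L \<longleftrightarrow>
     (\<forall>\<eta>. \<forall>D\<in>dists (F \<eta>). \<forall>h\<in>hyps (F \<eta>). \<forall>N.
        expected_risk (F \<eta>) (d \<eta>) (r \<eta>) L \<eta> h D N \<le> \<epsilon> \<eta> N)"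

definition models :: "(nat \<Rightarrow> ('x, 'y) problem) \<Rightarrow> ('x, 'y) learner \<Rightarrow> nat \<Rightarrow> ('x \<Rightarrow> 'y) set" where
  "models F L \<eta> =
     (\<Union>h\<in>hyps (F \<eta>). \<Union>S\<in>lists (inputs (F \<eta>)). set_pmf (L (labelled h S) \<eta>))"

text \<open>
  Models are extensional functions, so that counting models counts functions on the input space
  and not their extensions to the whole type.
\<close>
definition learner_for :: "(nat \<Rightarrow> ('x, 'y) problem) \<Rightarrow> ('x, 'y) learner \<Rightarrow> bool" where
  "learner_for F L \<longleftrightarrow> (\<forall>\<eta>. models F L \<eta> \<subseteq> inputs (F \<eta>) \<rightarrow>\<^sub>E labels (F \<eta>))"

definition param_bits_le ::
  "(nat \<Rightarrow> ('x, 'y) problem) \<Rightarrow> ('x, 'y) learner \<Rightarrow> (nat \<Rightarrow> real) \<Rightarrow> bool" where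
  "param_bits_le F L p \<longleftrightarrow>
     (\<forall>\<eta>. finite (models F L \<eta>) \<and> real (card (models F L \<eta>)) \<le> 2 powr p \<eta>)"


section \<open>Bit strings, entropy, statistical distance\<close>

definition bits :: "nat \<Rightarrow> bool list set" where
  "bits m = {w. length w = m}"

abbreviation uniform_bits :: "nat \<Rightarrow> bool list pmf" where
  "uniform_bits m \<equiv> pmf_of_set (bits m)"

definition inner_F2 :: "bool list \<Rightarrow> bool list \<Rightarrow> bool" where
  "inner_F2 v w \<longleftrightarrow> odd (card {i. i < length v \<and> v ! i \<and> w ! i})"

definition min_entropy :: "'a pmf \<Rightarrow> real" where
  "min_entropy X = - log 2 (SUP \<omega>. pmf X \<omega>)"

definition stat_dist :: "'a pmf \<Rightarrow> 'a pmf \<Rightarrow> real" where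
  "stat_dist X Y = (SUP A. \<bar>measure_pmf.prob X A - measure_pmf.prob Y A\<bar>)"

definition negligible :: "(nat \<Rightarrow> real) \<Rightarrow> bool" where
  "negligible f \<longleftrightarrow>
     (\<forall>p::real poly. (\<forall>\<^sub>F \<eta> in sequentially. poly p (real \<eta>) > 0) \<longrightarrow>
        (\<forall>\<^sub>F \<eta> in sequentially. f \<eta> < 1 / poly p (real \<eta>)))"

text \<open>A parameter that is polynomial in \<open>\<eta>\<close>, i.e. of size \<open>\<eta>\<^bsup>\<Theta>(1)\<^esup>\<close>.\<close>
definition polynomial_size :: "(nat \<Rightarrow> nat) \<Rightarrow> bool" where
  "polynomial_size f \<longleftrightarrow>
     (\<exists>a>0. \<exists>b. \<forall>\<^sub>F \<eta> in sequentially.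
        real \<eta> powr a \<le> real (f \<eta>) \<and> real (f \<eta>) \<le> real \<eta> powr b)"


section \<open>Samplers\<close>

text \<open>
  The variable \<open>Y\<close> that replaces the sampled bits is jointly distributed with the seed: it is given
  by its conditional distributions \<open>Y u\<close>, each of which has the required min-entropy (as in
  Vadhan's theorem on averaging samplers). A \<open>Y\<close> independent of the seed cannot exist in general:
  if half of the bits of \<open>X\<close> are constant, then the set of constant positions in the sampled
  string depends on the seed.
\<close>
definition is_sampler ::
  "real \<Rightarrow> real \<Rightarrow> nat \<Rightarrow> nat \<Rightarrow> nat \<Rightarrow> (bool list \<Rightarrow> nat set) \<Rightarrow> bool" where
  "is_sampler \<kappa> \<delta> M t r samp \<longleftrightarrow>
     (\<forall>u\<in>bits r. samp u \<subseteq> {..<M} \<and> card (samp u) = t) \<and>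
     (\<forall>\<mu> X. set_pmf X \<subseteq> bits M \<and> min_entropy X \<ge> \<mu> * real M \<longrightarrow>
        (\<exists>Y. (\<forall>u\<in>bits r. set_pmf (Y u) \<subseteq> bits t \<and> min_entropy (Y u) \<ge> (\<mu> - \<kappa>) * real t) \<and>
             stat_dist
               (do { u \<leftarrow> uniform_bits r; x \<leftarrow> X; return_pmf (u, nths x (samp u)) })
               (do { u \<leftarrow> uniform_bits r; y \<leftarrow> Y u; return_pmf (u, y) }) \<le> \<delta>))"


section \<open>Codes\<close>

definition symbols :: "nat \<Rightarrow> bool list \<Rightarrow> bool list list" where
  "symbols l x = map (\<lambda>i. take l (drop (i * l) x)) [0..<length x div l]"

definition hamming :: "'a list \<Rightarrow> 'a list \<Rightarrow> nat" where
  "hamming xs ys = card {i. i < length xs \<and> xs ! i \<noteq> ys ! i}"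

definition words :: "nat \<Rightarrow> nat \<Rightarrow> bool list list set" where
  "words l m = {w. length w = m \<and> set w \<subseteq> bits l}"

text \<open>The bit string is padded with zeros to \<open>k\<close> symbols of \<open>l\<close> bits each.\<close>
definition to_message :: "nat \<Rightarrow> nat \<Rightarrow> bool list \<Rightarrow> bool list list" where
  "to_message l k w = symbols l (w @ replicate (k * l - length w) False)"

definition rs_encode :: "'a ring \<Rightarrow> 'a list \<Rightarrow> 'a list \<Rightarrow> 'a list" where
  "rs_encode K pts m =
     map (\<lambda>a. \<Oplus>\<^bsub>K\<^esub>i\<in>{..<length m}. (m ! i) \<otimes>\<^bsub>K\<^esub> (a [^]\<^bsub>K\<^esub> i)) pts"

text \<open>Nearest-codeword decoding.\<close>
definition rs_decode :: "bool list ring \<Rightarrow> bool list list \<Rightarrow> nat \<Rightarrow> nat \<Rightarrow> bool list list \<Rightarrow> bool list list"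
  where
  "rs_decode K pts l k y = arg_min (\<lambda>m. hamming (rs_encode K pts m) y) (\<lambda>m. m \<in> words l k)"

text \<open>
  \<open>enc\<close> encodes \<open>m\<close>-bit strings as \<open>len\<close> symbols of \<open>l\<close> bits, and can correct more than \<open>t\<close>
  symbol errors.
\<close>
definition corrects_more_than ::
  "real \<Rightarrow> nat \<Rightarrow> nat \<Rightarrow> nat \<Rightarrow> (bool list \<Rightarrow> bool list list) \<Rightarrow> bool" where
  "corrects_more_than t l m len enc \<longleftrightarrow>
     (\<forall>w\<in>bits m. enc w \<in> words l len) \<and>
     (\<exists>e dec. real e > t \<and>
        (\<forall>w\<in>bits m. \<forall>y\<in>words l len. hamming (enc w) y \<le> e \<longrightarrow> dec y = w))"


section \<open>Probabilistic polynomial time\<close>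

datatype tape_sym = Blank | Sep | Bit bool

text \<open>
  One-tape machines with states \<open>{..<num_states}\<close>, initial state \<open>0\<close> and halting state
  \<open>num_states\<close>; the third argument of the transition function is a fresh coin.
\<close>
record ptm =
  num_states :: nat
  trans :: "nat \<Rightarrow> tape_sym \<Rightarrow> bool \<Rightarrow> nat \<times> tape_sym \<times> int"

definition wf_ptm :: "ptm \<Rightarrow> bool" where
  "wf_ptm B \<longleftrightarrow> 0 < num_states B \<and>
     (\<forall>q<num_states B. \<forall>a c. trans B q a c \<in> {..num_states B} \<times> UNIV \<times> {-1, 0, 1})"

type_synonym config = "nat \<times> (int \<Rightarrow> tape_sym) \<times> int"

fun ptm_step :: "ptm \<Rightarrow> bool \<Rightarrow> config \<Rightarrow> config" where
  "ptm_step B c (q, T, i) =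
     (if q = num_states B then (q, T, i)
      else (case trans B q (T i) c of (q', a, j) \<Rightarrow> (q', T(i := a), i + j)))"

definition encode_strings :: "bool list list \<Rightarrow> tape_sym list" where
  "encode_strings ws = concat (map (\<lambda>w. map Bit w @ [Sep]) ws)"

definition init_config :: "tape_sym list \<Rightarrow> config" where
  "init_config w = (0, (\<lambda>i. if 0 \<le> i \<and> i < int (length w) then w ! nat i else Blank), 0)"

definition ptm_run :: "ptm \<Rightarrow> bool list \<Rightarrow> bool list list \<Rightarrow> config" where
  "ptm_run B coins ws = fold (ptm_step B) coins (init_config (encode_strings ws))"

text \<open>
  A halted machine does not move, so one may run it for exactly as many steps as a given time
  bound allows.
\<close>
definition runs_in_time :: "ptm \<Rightarrow> nat poly \<Rightarrow> bool" where
  "runs_in_time B p \<longleftrightarrow> wf_ptm B \<and>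
     (\<forall>ws coins. length coins = poly p (length (encode_strings ws)) \<longrightarrow>
        fst (ptm_run B coins ws) = num_states B)"

definition ptm_output :: "config \<Rightarrow> bool list list \<Rightarrow> bool" where
  "ptm_output cfg ws \<longleftrightarrow> (case cfg of (q, T, i) \<Rightarrow>
     (\<forall>j<length (encode_strings ws). T (int j) = encode_strings ws ! j) \<and>
     T (int (length (encode_strings ws))) = Blank)"


section \<open>Signature schemes\<close>

definition sig_correct ::
  "(nat \<Rightarrow> (bool list \<times> bool list) pmf) \<Rightarrow> (bool list \<Rightarrow> bool list \<Rightarrow> bool list) \<Rightarrow>
   (bool list \<Rightarrow> bool list \<Rightarrow> bool list \<Rightarrow> bool) \<Rightarrow> bool" where
  "sig_correct Gen Sign Verify \<longleftrightarrow>
     (\<forall>\<eta> m. measure_pmf.prob (Gen \<eta>) {(vk, sk). Verify vk m (Sign sk m)} = 1)"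

definition forge_prob ::
  "(nat \<Rightarrow> (bool list \<times> bool list) pmf) \<Rightarrow> (bool list \<Rightarrow> bool list \<Rightarrow> bool list) \<Rightarrow>
   (bool list \<Rightarrow> bool list \<Rightarrow> bool list \<Rightarrow> bool) \<Rightarrow>
   ptm \<Rightarrow> nat poly \<Rightarrow> bool list \<Rightarrow> nat \<Rightarrow> real" where
  "forge_prob Gen Sign Verify B p m \<eta> =
     measure_pmf.prob
       (do { (vk, sk) \<leftarrow> Gen \<eta>;
             let ws = [vk, m, Sign sk m];
             coins \<leftarrow> uniform_bits (poly p (length (encode_strings ws)));
             return_pmf (vk, ptm_run B coins ws) })
       {(vk, cfg). \<exists>m' \<sigma>'. ptm_output cfg [m', \<sigma>'] \<and> m' \<noteq> m \<and> Verify vk m' \<sigma>'}"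

definition weakly_unforgeable ::
  "(nat \<Rightarrow> (bool list \<times> bool list) pmf) \<Rightarrow> (bool list \<Rightarrow> bool list \<Rightarrow> bool list) \<Rightarrow>
   (bool list \<Rightarrow> bool list \<Rightarrow> bool list \<Rightarrow> bool) \<Rightarrow> bool" where
  "weakly_unforgeable Gen Sign Verify \<longleftrightarrow>
     (\<forall>B p m. runs_in_time B p \<longrightarrow> negligible (forge_prob Gen Sign Verify B p m))"


section \<open>The learning problem\<close>

text \<open>
  The field with \<open>2\<^sup>\<ell>\<close> elements is represented on the bit strings of length \<open>\<ell> = sym_len\<close>, so that
  an input is both a bit string and a vector of symbols. \<open>ecc_len \<eta> m\<close> is the number of symbols
  of \<open>[w]\<close> for \<open>w\<close> of length \<open>m\<close>.
\<close>
record construction =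
  n_par :: "nat \<Rightarrow> nat"
  alpha :: "nat \<Rightarrow> nat"
  rate :: real
  sym_len :: "nat \<Rightarrow> nat"
  fld :: "nat \<Rightarrow> bool list ring"
  points :: "nat \<Rightarrow> bool list list"
  kappa1 :: "nat \<Rightarrow> real"
  kappa2 :: real
  seed_len :: "nat \<Rightarrow> nat"
  samp :: "nat \<Rightarrow> bool list \<Rightarrow> nat set"
  ecc :: "nat \<Rightarrow> bool list \<Rightarrow> bool list list"
  ecc_len :: "nat \<Rightarrow> nat \<Rightarrow> nat"
  Gen :: "nat \<Rightarrow> (bool list \<times> bool list) pmf"
  Sign :: "bool list \<Rightarrow> bool list \<Rightarrow> bool list"
  Verify :: "bool list \<Rightarrow> bool list \<Rightarrow> bool list \<Rightarrow> bool"
  vk_len :: "nat \<Rightarrow> nat"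
  sig_len :: "nat \<Rightarrow> nat"

definition k_par :: "construction \<Rightarrow> nat \<Rightarrow> nat" where
  "k_par P \<eta> = nat \<lfloor>rate P * real (n_par P \<eta>)\<rfloor>"

definition budget :: "construction \<Rightarrow> nat \<Rightarrow> real" where
  "budget P \<eta> = (1 - sqrt (rate P)) * real (n_par P \<eta>)"

definition symbol_dist :: "construction \<Rightarrow> nat \<Rightarrow> bool list \<Rightarrow> bool list \<Rightarrow> real" where
  "symbol_dist P \<eta> x x' = real (hamming (symbols (sym_len P \<eta>) x) (symbols (sym_len P \<eta>) x'))"

text \<open>Number of symbols preceding the Reed-Solomon block, and of the whole input.\<close>
definition rs_offset :: "construction \<Rightarrow> nat \<Rightarrow> nat" where
  "rs_offset P \<eta> =
     ecc_len P \<eta> (seed_len P \<eta>) + ecc_len P \<eta> (n_par P \<eta>) + ecc_len P \<eta> (vk_len P \<eta>)"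

definition num_symbols :: "construction \<Rightarrow> nat \<Rightarrow> nat" where
  "num_symbols P \<eta> = rs_offset P \<eta> + n_par P \<eta> + ecc_len P \<eta> 1"

definition LEnc :: "construction \<Rightarrow> nat \<Rightarrow> bool list \<Rightarrow> bool list list" where
  "LEnc P \<eta> w =
     rs_encode (fld P \<eta>) (points P \<eta>) (to_message (sym_len P \<eta>) (k_par P \<eta>) w)"

definition input_dist :: "construction \<Rightarrow> nat \<Rightarrow> bool list \<Rightarrow> bool list pmf" where
  "input_dist P \<eta> s = do {
     u \<leftarrow> uniform_bits (seed_len P \<eta>);
     v \<leftarrow> uniform_bits (n_par P \<eta>);
     b \<leftarrow> pmf_of_set (UNIV :: bool set);
     (vk, sk) \<leftarrow> Gen P \<eta>;
     return_pmf (concat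
       (ecc P \<eta> u @ ecc P \<eta> v @ ecc P \<eta> vk @ LEnc P \<eta> (b # Sign P sk [b]) @
        ecc P \<eta> [b \<noteq> inner_F2 v (nths s (samp P \<eta> u))])) }"

definition input_space :: "construction \<Rightarrow> nat \<Rightarrow> bool list set" where
  "input_space P \<eta> = bits (num_symbols P \<eta> * sym_len P \<eta>)"

definition target :: "construction \<Rightarrow> nat \<Rightarrow> bool list \<Rightarrow> bool" where
  "target P \<eta> = (\<lambda>x\<in>input_space P \<eta>.
     hd (concat (rs_decode (fld P \<eta>) (points P \<eta>) (sym_len P \<eta>) (k_par P \<eta>)
       (take (n_par P \<eta>) (drop (rs_offset P \<eta>) (symbols (sym_len P \<eta>) x))))))"

definition learning_problem :: "construction \<Rightarrow> nat \<Rightarrow> (bool list, bool) problem" where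
  "learning_problem P \<eta> =
     \<lparr> inputs = input_space P \<eta>,
       labels = UNIV,
       dists = {input_dist P \<eta> s | s. s \<in> bits (alpha P \<eta>)},
       hyps = {target P \<eta>} \<rparr>"

text \<open>
  Standing assumptions. Those on a single \<open>\<eta>\<close> are required for all large \<open>\<eta>\<close> only: \<open>n < \<eta>\<close>, for
  instance, is impossible for \<open>\<eta> = 0\<close>. The real \<open>\<kappa>\<close> is the upper bound on the sampler's parameters;
  the sampler error is \<open>exp (-\<Theta>(\<alpha> \<kappa>\<^sub>1)) + exp (-\<alpha>\<^bsup>\<kappa>\<^sub>2\<^esup>)\<close>.
\<close>
definition valid_construction :: "real \<Rightarrow> construction \<Rightarrow> bool" where
  "valid_construction \<kappa> P \<longleftrightarrow>
     polynomial_size (n_par P) \<and> polynomial_size (alpha P) \<and>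
     (\<forall>\<^sub>F \<eta> in sequentially. n_par P \<eta> < \<eta> \<and> \<eta> < alpha P \<eta>) \<and>
     0 < rate P \<and> rate P < 1 / 4 \<and>
     (\<lambda>\<eta>. real (sym_len P \<eta>)) \<in> \<Theta>(\<lambda>\<eta>. ln (real \<eta>)) \<and>
     (\<forall>\<^sub>F \<eta> in sequentially.
        field (fld P \<eta>) \<and> carrier (fld P \<eta>) = bits (sym_len P \<eta>) \<and>
        length (points P \<eta>) = n_par P \<eta> \<and> distinct (points P \<eta>) \<and>
        set (points P \<eta>) \<subseteq> carrier (fld P \<eta>)) \<and>
     0 < kappa2 P \<and> kappa2 P < 1 \<and> kappa2 P \<le> \<kappa> \<and>
     (\<forall>\<^sub>F \<eta> in sequentially. 0 < kappa1 P \<eta> \<and> kappa1 P \<eta> < 1 \<and> kappa1 P \<eta> \<le> \<kappa>) \<and>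
     kappa1 P \<in> \<Omega>(\<lambda>\<eta>. 1 / ln (real \<eta>)) \<and>
     (\<lambda>\<eta>. real (seed_len P \<eta>)) \<in> \<Theta>(\<lambda>\<eta>. real (alpha P \<eta>) powr kappa2 P) \<and>
     (\<exists>c>0. \<forall>\<^sub>F \<eta> in sequentially.
        is_sampler (kappa1 P \<eta>)
          (exp (- c * real (alpha P \<eta>) * kappa1 P \<eta>) + exp (- (real (alpha P \<eta>) powr kappa2 P)))
          (alpha P \<eta>) (n_par P \<eta>) (seed_len P \<eta>) (samp P \<eta>)) \<and>
     (\<forall>\<^sub>F \<eta> in sequentially. \<forall>m\<in>{seed_len P \<eta>, n_par P \<eta>, vk_len P \<eta>, 1}.
        corrects_more_than (budget P \<eta>) (sym_len P \<eta>) m (ecc_len P \<eta> m) (ecc P \<eta>)) \<and>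
     sig_correct (Gen P) (Sign P) (Verify P) \<and>
     weakly_unforgeable (Gen P) (Sign P) (Verify P) \<and>
     (\<forall>\<^sub>F \<eta> in sequentially.
        (\<forall>(vk, sk)\<in>set_pmf (Gen P \<eta>).
           length vk = vk_len P \<eta> \<and> (\<forall>b. length (Sign P sk [b]) = sig_len P \<eta>)) \<and>
        1 + sig_len P \<eta> \<le> k_par P \<eta> * sym_len P \<eta>) \<and>
     (\<exists>c. \<forall>\<^sub>F \<eta> in sequentially. real (num_symbols P \<eta> * sym_len P \<eta>) \<le> real \<eta> ^ c)"

end

theory Submission
  imports Defs "HOL-Algebra.Polynomial_Divisibility" "HOL-Real_Asymp.Real_Asymp"
begin

text \<open>
  The attacker replaces the Reed-Solomon block by a word halfway between the encodings of the two
  labels, each with its own signature; since \<open>1 - \<surd>R > 1/2\<close> this respects the budget, and the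
  perturbed input carries the label \<open>b\<close> only through \<open>b + \<langle>v, s|\<^bsub>samp(u)\<^esub>\<rangle>\<close>. A model of \<open>\<alpha>/2\<close> bits
  leaves min-entropy about \<open>\<alpha>/2\<close> in a uniform \<open>s\<close>, so the sampled bits have linear min-entropy, and
  by the leftover hash lemma the inner product with the random \<open>v\<close> is nearly uniform. Hence the
  model errs on the perturbed input with probability close to \<open>1/2\<close>, on average over \<open>s\<close>.
\<close>

section \<open>Unpredictability of sampled inner products\<close>

lemma bits_0: "bits 0 = {[]}" by (auto simp: bits_def)

lemma bits_Suc: "bits (Suc n) = Cons True ` bits n \<union> Cons False ` bits n"
proof -
  have "w \<in> Cons True ` bits n \<union> Cons False ` bits n" if "w \<in> bits (Suc n)" for w
    using that by (cases w; cases "hd w") (auto simp: bits_def)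
  thus ?thesis by (auto simp: bits_def)
qed

lemma finite_bits [simp]: "finite (bits n)"
  by (induction n) (auto simp: bits_0 bits_Suc)

lemma card_bits [simp]: "card (bits n) = 2 ^ n"
proof -
  have "bits n = {xs. set xs \<subseteq> (UNIV :: bool set) \<and> length xs = n}" by (auto simp: bits_def)
  thus ?thesis using card_lists_length_eq[of "UNIV :: bool set" n] by (simp add: card_UNIV_bool)
qed

lemma bits_not_empty [simp]: "bits n \<noteq> {}"
  by (metis card_bits card.empty power_not_zero zero_neq_numeral)

lemma sum_bits_Suc:
  fixes f :: "bool list \<Rightarrow> real"
  shows "(\<Sum>v\<in>bits (Suc n). f v) = (\<Sum>v\<in>bits n. f (True # v)) + (\<Sum>v\<in>bits n. f (False # v))"
  unfolding bits_Suc by (subst sum.union_disjoint) (auto simp: sum.reindex)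

lemma inner_F2_Nil [simp]: "\<not> inner_F2 [] w" by (simp add: inner_F2_def)

lemma inner_F2_Cons [simp]: "inner_F2 (a # v) (b # w) \<longleftrightarrow> (a \<and> b) \<noteq> inner_F2 v w"
proof -
  let ?S = "{i. i < length v \<and> v ! i \<and> w ! i}"
  have "{i. i < length (a # v) \<and> (a # v) ! i \<and> (b # w) ! i} =
      (if a \<and> b then {0} else {}) \<union> Suc ` ?S"
    by (auto simp: less_Suc_eq_0_disj)
  moreover have "card ((if a \<and> b then {0} else {}) \<union> Suc ` ?S) = (if a \<and> b then 1 else 0) + card ?S"
    by (subst card_Un_disjoint) (auto simp: card_image)
  ultimately have "inner_F2 (a # v) (b # w) \<longleftrightarrow> odd ((if a \<and> b then 1 else 0) + card ?S)"
    by (simp only: inner_F2_def)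
  thus ?thesis by (cases "a \<and> b") (auto simp: inner_F2_def)
qed

text \<open>The additive character of F_2^n indexed by \<open>v\<close>. Its mean under a
  distribution of \<open>w\<close> is the bias of the inner product, so prediction becomes a
  question about Fourier coefficients.\<close>

definition character :: "bool list \<Rightarrow> bool list \<Rightarrow> real" where
  "character v w = (if inner_F2 v w then - 1 else 1)"

lemma character_Cons:
  "character (a # v) (b # w) = (if a \<and> b then - character v w else character v w)"
  by (auto simp: character_def)

text \<open>Split off the first bit of \<open>v\<close>: the two halves of the sum agree when
  \<open>w\<close> and \<open>w'\<close> start with the same bit and cancel when they do
  not.\<close>

lemma character_orthogonal:
  "w \<in> bits n \<Longrightarrow> w' \<in> bits n \<Longrightarrow>
     (\<Sum>v\<in>bits n. character v w * character v w') = (if w = w' then 2 ^ n else 0)"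
proof (induction n arbitrary: w w')
  case 0
  thus ?case by (auto simp: bits_0 character_def)
next
  case (Suc n)
  obtain a y b z where "w = a # y" "w' = b # z" "y \<in> bits n" "z \<in> bits n"
    using Suc.prems by (auto simp: bits_Suc)
  with Suc.IH[of y z] show ?case
    by (cases a; cases b) (auto simp: sum_bits_Suc character_Cons sum_negf)
qed

section \<open>Min-entropy and the bias of an inner product\<close>

lemma bdd_above_pmf: "bdd_above (range (pmf Z))"
  by (rule bdd_aboveI[of _ 1]) (auto simp: pmf_le_1)

lemma min_entropy_ge_iff: "min_entropy Z \<ge> k \<longleftrightarrow> (\<forall>z. pmf Z z \<le> 2 powr (- k))"
proof -
  \<comment> \<open>An atom of positive mass makes the supremum positive, so the logarithm can be
    inverted.\<close>
  obtain z where "z \<in> set_pmf Z" using set_pmf_not_empty by fast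
  hence "0 < pmf Z z" by (simp add: pmf_positive)
  also have "pmf Z z \<le> (SUP \<omega>. pmf Z \<omega>)" by (rule cSUP_upper[OF _ bdd_above_pmf]) simp
  finally have "min_entropy Z \<ge> k \<longleftrightarrow> (SUP \<omega>. pmf Z \<omega>) \<le> 2 powr (- k)"
    unfolding min_entropy_def by (subst log_le_iff[symmetric]) auto
  also have "\<dots> \<longleftrightarrow> (\<forall>z. pmf Z z \<le> 2 powr (- k))"
    by (subst cSUP_le_iff[OF _ bdd_above_pmf]) auto
  finally show ?thesis .
qed

text \<open>Parseval's identity: after expanding the square and exchanging sums, orthogonality
  leaves only the diagonal.\<close>

lemma sum_square_bias:
  fixes p :: "bool list \<Rightarrow> real"
  shows "(\<Sum>v\<in>bits n. (\<Sum>w\<in>bits n. p w * character v w)\<^sup>2) = 2 ^ n * (\<Sum>w\<in>bits n. (p w)\<^sup>2)"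
proof -
  have "(\<Sum>v\<in>bits n. (\<Sum>w\<in>bits n. p w * character v w)\<^sup>2) =
      (\<Sum>v\<in>bits n. \<Sum>w\<in>bits n. \<Sum>w'\<in>bits n. p w * p w' * (character v w * character v w'))"
    by (simp add: power2_eq_square sum_product mult_ac)
  also have "\<dots> = (\<Sum>w\<in>bits n. \<Sum>w'\<in>bits n. p w * p w' * (\<Sum>v\<in>bits n. character v w * character v w'))"
    by (subst sum.swap, rule sum.cong[OF refl], subst sum.swap) (simp add: sum_distrib_left)
  also have "\<dots> = (\<Sum>w\<in>bits n. \<Sum>w'\<in>bits n. if w = w' then 2 ^ n * (p w)\<^sup>2 else 0)"
    by (intro sum.cong refl) (auto simp: character_orthogonal power2_eq_square)
  also have "\<dots> = 2 ^ n * (\<Sum>w\<in>bits n. (p w)\<^sup>2)"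
    by (simp add: sum.delta sum_distrib_left)
  finally show ?thesis .
qed

text \<open>The leftover hash argument with the inner product as hash function: Parseval turns the
  collision probability into an L2 bound on the biases, and Cauchy-Schwarz turns that into an L1
  bound.\<close>

lemma sum_abs_bias_le:
  assumes Y: "set_pmf Y \<subseteq> bits n" "min_entropy Y \<ge> k"
  shows "(\<Sum>v\<in>bits n. \<bar>\<Sum>w\<in>bits n. pmf Y w * character v w\<bar>) \<le> 2 ^ n * 2 powr (- k / 2)"
proof -
  let ?b = "\<lambda>v. \<Sum>w\<in>bits n. pmf Y w * character v w"
  \<comment> \<open>Collision probability: one factor is at most \<open>2 powr (- k)\<close>, the
    other sums to 1.\<close>
  have "(\<Sum>w\<in>bits n. (pmf Y w)\<^sup>2) \<le> (\<Sum>w\<in>bits n. pmf Y w * 2 powr (- k))"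
    unfolding power2_eq_square
    using Y(2) by (intro sum_mono mult_left_mono) (auto simp: min_entropy_ge_iff)
  also have "\<dots> = 2 powr (- k)"
    using Y(1) by (simp flip: sum_distrib_right add: sum_pmf_eq_1)
  finally have "(\<Sum>v\<in>bits n. (?b v)\<^sup>2) \<le> 2 ^ n * 2 powr (- k)"
    unfolding sum_square_bias by simp
  hence L2: "L2_set ?b (bits n) \<le> sqrt (2 ^ n * 2 powr (- k))"
    by (simp add: L2_set_def)
  \<comment> \<open>Cauchy-Schwarz against the constant 1, whose L2 norm is
    \<open>sqrt (2 ^ n)\<close>.\<close>
  have "(\<Sum>v\<in>bits n. \<bar>1\<bar> * \<bar>?b v\<bar>) \<le> L2_set (\<lambda>_. 1) (bits n) * L2_set ?b (bits n)"
    by (rule L2_set_mult_ineq)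
  also have "\<dots> \<le> sqrt (2 ^ n) * sqrt (2 ^ n * 2 powr (- k))"
    using L2 by (intro mult_mono) (simp_all add: L2_set_def sum_nonneg)
  also have "\<dots> = 2 ^ n * 2 powr (- k / 2)"
    by (simp add: real_sqrt_mult mult.assoc[symmetric] powr_half_sqrt[of "2 powr - k", symmetric] powr_powr)
  finally show ?thesis by simp
qed

lemma uniform_bool_bind:
  "pmf (do {b \<leftarrow> pmf_of_set (UNIV :: bool set); N b}) x = (pmf (N True) x + pmf (N False) x) / 2"
  by (subst pmf_bind, subst integral_pmf_of_set) (simp_all add: UNIV_bool)

text \<open>The errors of \<open>g\<close> for the two values of \<open>b\<close> add up to 1 plus
  or minus the character, or to exactly 1, so only the bias can push the error probability away from
  1/2.\<close>

lemma inner_product_unpredictable_fixed: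
  assumes Y: "set_pmf Y \<subseteq> bits n"
  shows "pmf (do {b \<leftarrow> pmf_of_set UNIV; w \<leftarrow> Y; return_pmf (g (b \<noteq> inner_F2 v w) \<noteq> b)}) True \<ge>
     1 / 2 - \<bar>\<Sum>w\<in>bits n. pmf Y w * character v w\<bar> / 2"
proof -
  let ?S = "\<Sum>w\<in>bits n. pmf Y w * character v w"
  \<comment> \<open>A predictor seeing one bit is constant (\<open>c = 0\<close>), the identity
    (\<open>c = - 1\<close>) or the negation (\<open>c = 1\<close>).\<close>
  obtain c :: real where c: "\<bar>c\<bar> \<le> 1"
    "\<And>w. indicator {True} (g (True \<noteq> inner_F2 v w) \<noteq> True) +
      indicator {True} (g (False \<noteq> inner_F2 v w) \<noteq> False) = 1 + c * character v w"
  proof (rule that[of "if g True = g False then 0 else if g True then - 1 else 1"], goal_cases)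
    case (2 w)
    show ?case by (cases "g True"; cases "g False"; cases "inner_F2 v w") (auto simp: character_def)
  qed simp
  have exp: "pmf (do {w \<leftarrow> Y; return_pmf (F w)}) True = (\<Sum>w\<in>bits n. pmf Y w * indicator {True} (F w))"
    for F
    using Y by (subst pmf_bind, subst integral_measure_pmf[of "bits n"])
      (auto simp: indicator_def intro!: sum.cong)
  have "pmf (do {b \<leftarrow> pmf_of_set UNIV; w \<leftarrow> Y; return_pmf (g (b \<noteq> inner_F2 v w) \<noteq> b)}) True =
     (\<Sum>w\<in>bits n. pmf Y w * (indicator {True} (g (True \<noteq> inner_F2 v w) \<noteq> True) +
      indicator {True} (g (False \<noteq> inner_F2 v w) \<noteq> False))) / 2"
    unfolding uniform_bool_bind exp by (simp only: distrib_left sum.distrib)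
  also have "\<dots> = ((\<Sum>w\<in>bits n. pmf Y w) + c * ?S) / 2"
    unfolding c(2) by (simp add: distrib_left sum.distrib sum_distrib_left mult_ac)
  also have "(\<Sum>w\<in>bits n. pmf Y w) = 1" using Y by (simp add: sum_pmf_eq_1)
  also have "- (c * ?S) \<le> \<bar>?S\<bar>"
    using mult_right_mono[OF c(1), of "\<bar>?S\<bar>"] abs_mult[of c ?S] by linarith
  hence "(1 + c * ?S) / 2 \<ge> 1 / 2 - \<bar>?S\<bar> / 2" by (simp add: field_simps)
  finally show ?thesis .
qed

text \<open>The bound for fixed \<open>v\<close> holds for every predictor, so the predictor may
  depend on \<open>v\<close>; averaging over \<open>v\<close> then brings in the L1 bound.\<close>

lemma inner_product_unpredictable:
  assumes Y: "set_pmf Y \<subseteq> bits n" "min_entropy Y \<ge> k"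
  shows "pmf (do {v \<leftarrow> uniform_bits n; b \<leftarrow> pmf_of_set UNIV; w \<leftarrow> Y;
       return_pmf (g v (b \<noteq> inner_F2 v w) \<noteq> b)}) True \<ge> 1 / 2 - 2 powr (- k / 2) / 2"
proof -
  let ?S = "\<lambda>v. \<bar>\<Sum>w\<in>bits n. pmf Y w * character v w\<bar>"
  have "1 / 2 - 2 powr (- k / 2) / 2 = (2 ^ n - 2 ^ n * 2 powr (- k / 2)) / 2 / (2 ^ n :: real)"
    by (simp add: field_simps)
  also have "\<dots> \<le> (2 ^ n - (\<Sum>v\<in>bits n. ?S v)) / 2 / 2 ^ n"
    using sum_abs_bias_le[OF Y] by (intro divide_right_mono) auto
  also have "\<dots> = (\<Sum>v\<in>bits n. 1 / 2 - ?S v / 2) / 2 ^ n"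
    unfolding sum_subtractf by (simp add: sum_divide_distrib[symmetric] diff_divide_distrib)
  also have "\<dots> \<le> (\<Sum>v\<in>bits n. pmf (do {b \<leftarrow> pmf_of_set UNIV; w \<leftarrow> Y;
       return_pmf (g v (b \<noteq> inner_F2 v w) \<noteq> b)}) True) / 2 ^ n"
    by (intro divide_right_mono sum_mono inner_product_unpredictable_fixed Y(1)) auto
  also have "\<dots> = pmf (do {v \<leftarrow> uniform_bits n; b \<leftarrow> pmf_of_set UNIV; w \<leftarrow> Y;
       return_pmf (g v (b \<noteq> inner_F2 v w) \<noteq> b)}) True"
    by (subst (2) pmf_bind, subst integral_pmf_of_set) auto
  finally show ?thesis .
qed

section \<open>Comparing experiments draw by draw, and the sampled inner product\<close>

lemma integrable_pmf: "integrable (measure_pmf M) (\<lambda>x. pmf (f x) i)"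
  by (rule measure_pmf.integrable_const_bound[of _ 1]) (auto simp: pmf_le_1)

text \<open>A coupling rule: both experiments draw the same \<open>x\<close>, so a comparison for
  each draw survives averaging. Repeated use peels off a common prefix.\<close>

lemma pmf_bind_mono:
  assumes "\<And>x. x \<in> set_pmf M \<Longrightarrow> pmf (f x) i \<le> pmf (g x) j + c"
  shows "pmf (bind_pmf M f) i \<le> pmf (bind_pmf M g) j + c"
proof -
  have "pmf (bind_pmf M f) i \<le> (\<integral>x. pmf (g x) j + c \<partial>measure_pmf M)"
    unfolding pmf_bind
    by (intro integral_mono_AE Bochner_Integration.integrable_add integrable_pmf)
      (use assms in \<open>auto simp: AE_measure_pmf_iff\<close>)
  also have "\<dots> = pmf (bind_pmf M g) j + c"
    unfolding pmf_bind by (subst Bochner_Integration.integral_add) (auto intro: integrable_pmf)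
  finally show ?thesis .
qed

lemma pmf_bind_ge:
  assumes "\<And>x. x \<in> set_pmf M \<Longrightarrow> c \<le> pmf (f x) i"
  shows "c \<le> pmf (bind_pmf M f) i"
proof -
  have "(\<integral>x. c \<partial>measure_pmf M) \<le> pmf (bind_pmf M f) i"
    unfolding pmf_bind
    by (intro integral_mono_AE integrable_pmf) (use assms in \<open>auto simp: AE_measure_pmf_iff\<close>)
  thus ?thesis by simp
qed

lemma pmf_bind_le:
  assumes "\<And>x. x \<in> set_pmf M \<Longrightarrow> pmf (f x) i \<le> c"
  shows "pmf (bind_pmf M f) i \<le> c"
proof -
  have "pmf (bind_pmf M f) i \<le> (\<integral>x. c \<partial>measure_pmf M)"
    unfolding pmf_bind
    by (intro integral_mono_AE integrable_pmf) (use assms in \<open>auto simp: AE_measure_pmf_iff\<close>)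
  thus ?thesis by simp
qed

lemma pmf_bind_return_True:
  "pmf (do {x \<leftarrow> M; return_pmf (f x)}) True = measure_pmf.prob M {x. f x}"
proof -
  have "(\<lambda>x. pmf (return_pmf (f x)) True) = indicator {x. f x}" by (auto simp: indicator_def)
  thus ?thesis by (simp add: pmf_bind)
qed

lemma prob_diff_le_stat_dist:
  "\<bar>measure_pmf.prob Z A - measure_pmf.prob Y A\<bar> \<le> stat_dist Z Y"
  unfolding stat_dist_def
proof (rule cSUP_upper)
  have "\<bar>measure_pmf.prob Z A - measure_pmf.prob Y A\<bar> \<le> 1" for A
    using measure_pmf.prob_le_1[of Z A] measure_pmf.prob_le_1[of Y A]
      measure_nonneg[of Z A] measure_nonneg[of Y A] by linarith
  thus "bdd_above (range (\<lambda>A. \<bar>measure_pmf.prob Z A - measure_pmf.prob Y A\<bar>))"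
    by (intro bdd_aboveI[of _ 1]) auto
qed simp

text \<open>The sampled bits can be replaced by \<open>Y u\<close> at cost \<open>\<delta>\<close>,
  and every \<open>Y u\<close> has enough min-entropy for the inner product bound. \<open>K\<close>
  stands for side information independent of the secret, later the key pair.\<close>

lemma sampled_inner_product_unpredictable:
  fixes K :: "'k pmf"
  assumes samp: "is_sampler \<kappa> \<delta> M n r \<sigma>"
    and Z: "set_pmf Z \<subseteq> bits M" "min_entropy Z \<ge> \<theta> * real M"
  shows "pmf (do {s \<leftarrow> Z; k \<leftarrow> K; u \<leftarrow> uniform_bits r; v \<leftarrow> uniform_bits n; b \<leftarrow> pmf_of_set UNIV;
       return_pmf (g k u v (b \<noteq> inner_F2 v (nths s (\<sigma> u))) \<noteq> b)}) True \<ge>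
     1 / 2 - 2 powr (- ((\<theta> - \<kappa>) * real n) / 2) / 2 - \<delta>"
proof -
  obtain Y where Y: "\<And>u. u \<in> bits r \<Longrightarrow> set_pmf (Y u) \<subseteq> bits n"
      "\<And>u. u \<in> bits r \<Longrightarrow> min_entropy (Y u) \<ge> (\<theta> - \<kappa>) * real n"
    and sd: "stat_dist
               (do { u \<leftarrow> uniform_bits r; x \<leftarrow> Z; return_pmf (u, nths x (\<sigma> u)) })
               (do { u \<leftarrow> uniform_bits r; y \<leftarrow> Y u; return_pmf (u, y) }) \<le> \<delta>"
    (is "stat_dist ?SX ?SY \<le> \<delta>")
    using samp Z unfolding is_sampler_def by blast
  have set_uniform: "set_pmf (uniform_bits r) = bits r" by simp
  have "1 / 2 - 2 powr (- ((\<theta> - \<kappa>) * real n) / 2) / 2 \<le>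
     pmf (do {k \<leftarrow> K; u \<leftarrow> uniform_bits r; v \<leftarrow> uniform_bits n; b \<leftarrow> pmf_of_set UNIV; w \<leftarrow> Y u;
       return_pmf (g k u v (b \<noteq> inner_F2 v w) \<noteq> b)}) True"
    by (intro pmf_bind_ge inner_product_unpredictable) (use Y in auto)
  \<comment> \<open>\<open>v\<close> and \<open>b\<close> are independent of \<open>u\<close> and
    \<open>w\<close>, so they can be drawn earlier; \<open>(u, w)\<close> then appears as one draw,
    as in the guarantee of the sampler.\<close>
  also have "(do {k \<leftarrow> K; u \<leftarrow> uniform_bits r; v \<leftarrow> uniform_bits n; b \<leftarrow> pmf_of_set UNIV; w \<leftarrow> Y u;
       return_pmf (g k u v (b \<noteq> inner_F2 v w) \<noteq> b)}) =
     (do {k \<leftarrow> K; v \<leftarrow> uniform_bits n; b \<leftarrow> pmf_of_set UNIV; (u, w) \<leftarrow> ?SY;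
       return_pmf (g k u v (b \<noteq> inner_F2 v w) \<noteq> b)})"
    unfolding bind_assoc_pmf bind_return_pmf case_prod_conv
    by (subst bind_commute_pmf[of "uniform_bits r" "uniform_bits n"],
        subst bind_commute_pmf[of "uniform_bits r" "pmf_of_set UNIV"]) (rule refl)
  also have "pmf \<dots> True \<le> pmf (do {k \<leftarrow> K; v \<leftarrow> uniform_bits n; b \<leftarrow> pmf_of_set UNIV; (u, w) \<leftarrow> ?SX;
       return_pmf (g k u v (b \<noteq> inner_F2 v w) \<noteq> b)}) True + \<delta>"
  proof (intro pmf_bind_mono)
    fix k v b
    \<comment> \<open>With \<open>k\<close>, \<open>v\<close> and \<open>b\<close> fixed, a wrong
      guess is an event on \<open>(u, w)\<close> alone, so its probability moves by at most the
      statistical distance.\<close>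
    let ?A = "{(u, w). g k u v (b \<noteq> inner_F2 v w) \<noteq> b}"
    have "measure_pmf.prob ?SY ?A \<le> measure_pmf.prob ?SX ?A + \<delta>"
      using prob_diff_le_stat_dist[of ?SX ?A ?SY] sd by linarith
    thus "pmf (do {(u, w) \<leftarrow> ?SY; return_pmf (g k u v (b \<noteq> inner_F2 v w) \<noteq> b)}) True \<le>
       pmf (do {(u, w) \<leftarrow> ?SX; return_pmf (g k u v (b \<noteq> inner_F2 v w) \<noteq> b)}) True + \<delta>"
      unfolding case_prod_unfold pmf_bind_return_True .
  qed
  also have "(do {k \<leftarrow> K; v \<leftarrow> uniform_bits n; b \<leftarrow> pmf_of_set UNIV; (u, w) \<leftarrow> ?SX;
       return_pmf (g k u v (b \<noteq> inner_F2 v w) \<noteq> b)}) =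
     do {s \<leftarrow> Z; k \<leftarrow> K; u \<leftarrow> uniform_bits r; v \<leftarrow> uniform_bits n; b \<leftarrow> pmf_of_set UNIV;
       return_pmf (g k u v (b \<noteq> inner_F2 v (nths s (\<sigma> u))) \<noteq> b)}"
    unfolding bind_assoc_pmf bind_return_pmf case_prod_conv
    by (subst bind_commute_pmf[of Z K], subst bind_commute_pmf[of Z "uniform_bits r"],
        subst bind_commute_pmf[of Z "uniform_bits n"], subst bind_commute_pmf[of Z "pmf_of_set UNIV"],
        subst bind_commute_pmf[of "uniform_bits r" "uniform_bits n"],
        subst bind_commute_pmf[of "uniform_bits r" "pmf_of_set UNIV"]) (rule refl)
  finally show ?thesis by linarith
qed

section \<open>Conditioning the secret on the learned model\<close>

lemma finite_pmf_exists:
  fixes p :: "'a \<Rightarrow> real"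
  assumes "finite A" "\<And>x. p x \<ge> 0" "\<And>x. x \<notin> A \<Longrightarrow> p x = 0" "(\<Sum>x\<in>A. p x) = 1"
  obtains Z where "\<And>x. pmf Z x = p x"
proof -
  have "(\<integral>\<^sup>+x. ennreal (p x) \<partial>count_space UNIV) = (\<Sum>x\<in>A. ennreal (p x))"
    using assms by (intro nn_integral_count_space') auto
  also have "\<dots> = 1" using assms by (simp add: sum_ennreal)
  finally have "pmf (embed_pmf p) x = p x" for x
    using assms by (intro pmf_embed_pmf) auto
  thus ?thesis using that by blast
qed

text \<open>
  Conditioning the uniform secret on the learned model \<open>f\<close> leaves min-entropy \<open>\<theta> M\<close> unless \<open>f\<close> is
  output with probability below \<open>2\<^bsup>-(1-\<theta>)M\<^esup>\<close>; those rare models are discarded.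
\<close>
lemma short_model_lower_bound:
  fixes Q :: "bool list \<Rightarrow> 'f pmf" and err :: "'f \<Rightarrow> bool list \<Rightarrow> bool pmf"
  assumes F: "finite F" "\<And>s. s \<in> bits M \<Longrightarrow> set_pmf (Q s) \<subseteq> F"
    and c: "c \<ge> 0"
    and hard: "\<And>f Z. set_pmf Z \<subseteq> bits M \<Longrightarrow> min_entropy Z \<ge> \<theta> * real M \<Longrightarrow>
      c \<le> pmf (do {s \<leftarrow> Z; err f s}) True"
  shows "c * (1 - real (card F) * 2 powr (- ((1 - \<theta>) * real M))) \<le>
    pmf (do {s \<leftarrow> uniform_bits M; f \<leftarrow> Q s; err f s}) True"
proof -
  define \<tau> :: real where "\<tau> = 2 powr (- ((1 - \<theta>) * real M))"
  \<comment> \<open>For \<open>s\<close> in \<open>bits M\<close>, \<open>w f s\<close> is the joint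
    probability of secret and model, and \<open>W f\<close> is the marginal of the model;
    \<open>\<tau>\<close> separates rare models from the others.\<close>
  define w where "w f s = pmf (Q s) f / 2 ^ M" for f s
  define W where "W f = (\<Sum>s\<in>bits M. w f s)" for f
  define e where "e f s = pmf (err f s) True" for f s
  have w_nonneg: "w f s \<ge> 0" for f s by (simp add: w_def)
  have e_nonneg: "e f s \<ge> 0" for f s by (simp add: e_def)
  have per_model: "c * (W f - \<tau>) \<le> (\<Sum>s\<in>bits M. w f s * e f s)" for f
  \<comment> \<open>A rare model makes the left side nonpositive, while the right side is a sum of
    nonnegative terms.\<close>
  proof (cases "W f \<le> \<tau>")
    case True
    hence "c * (W f - \<tau>) \<le> 0" using c by (simp add: mult_nonneg_nonpos)
    also have "0 \<le> (\<Sum>s\<in>bits M. w f s * e f s)" by (intro sum_nonneg mult_nonneg_nonneg w_nonneg e_nonneg)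
    finally show ?thesis .
  next
    case False
    hence W: "W f > \<tau>" by simp
    have \<tau>: "\<tau> > 0" by (simp add: \<tau>_def)
    \<comment> \<open>\<open>Z\<close> is the law of the secret given that the model is
      \<open>f\<close>.\<close>
    obtain Z where Z: "\<And>s. pmf Z s = (if s \<in> bits M then w f s / W f else 0)"
    proof (rule finite_pmf_exists[of "bits M" "\<lambda>s. if s \<in> bits M then w f s / W f else 0"])
      show "(\<Sum>s\<in>bits M. if s \<in> bits M then w f s / W f else 0) = 1"
        using W \<tau> by (simp add: W_def flip: sum_divide_distrib)
    qed (use W \<tau> w_nonneg in \<open>auto\<close>)
    have supp: "set_pmf Z \<subseteq> bits M" by (auto simp: set_pmf_eq Z split: if_splits)
    have "pmf Z s \<le> 2 powr (- (\<theta> * real M))" for s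
    proof (cases "s \<in> bits M")
      case True
      \<comment> \<open>A joint weight is at most \<open>1 / 2 ^ M\<close>, and the marginal it is
        divided by exceeds \<open>\<tau>\<close>.\<close>
      have "pmf Z s \<le> (1 / 2 ^ M) / \<tau>"
        unfolding Z using True W \<tau> by (auto simp: w_def pmf_le_1 intro!: frac_le divide_right_mono)
      also have "\<dots> = 2 powr (- (\<theta> * real M))"
      proof -
        have "1 / 2 ^ M = (2 :: real) powr (- real M)" by (simp add: powr_minus powr_realpow divide_inverse)
        thus ?thesis unfolding \<tau>_def by (simp add: powr_diff[symmetric] algebra_simps)
      qed
      finally show ?thesis .
    qed (simp add: Z)
    hence "c \<le> pmf (do {s \<leftarrow> Z; err f s}) True"
      by (intro hard supp) (simp add: min_entropy_ge_iff)
    also have "\<dots> = (\<Sum>s\<in>bits M. pmf Z s * e f s)"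
      unfolding pmf_bind e_def using supp by (subst integral_measure_pmf[of "bits M"]) auto
    also have "\<dots> = (\<Sum>s\<in>bits M. w f s * e f s) / W f"
      by (simp add: Z sum_divide_distrib)
    finally have "c * W f \<le> (\<Sum>s\<in>bits M. w f s * e f s)" using W \<tau> by (simp add: field_simps)
    moreover have "c * (W f - \<tau>) \<le> c * W f" using c \<tau> by (intro mult_left_mono) auto
    ultimately show ?thesis by linarith
  qed
  \<comment> \<open>The marginals sum to 1 and each model forfeits \<open>\<tau>\<close>, whence the
    factor in the conclusion.\<close>
  have "(\<Sum>f\<in>F. W f) = (\<Sum>s\<in>bits M. (\<Sum>f\<in>F. pmf (Q s) f) / 2 ^ M)"
    unfolding W_def w_def by (subst sum.swap) (simp add: sum_divide_distrib)
  also have "\<dots> = 1" using F by (simp add: sum_pmf_eq_1)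
  finally have "c * (1 - real (card F) * \<tau>) = (\<Sum>f\<in>F. c * (W f - \<tau>))"
    by (simp add: sum_distrib_left[symmetric] sum_subtractf)
  also have "\<dots> \<le> (\<Sum>f\<in>F. \<Sum>s\<in>bits M. w f s * e f s)"
    by (intro sum_mono per_model)
  also have "\<dots> = (\<Sum>s\<in>bits M. (\<Sum>f\<in>F. pmf (Q s) f * e f s) / 2 ^ M)"
    by (subst sum.swap) (simp add: w_def sum_divide_distrib)
  also have "\<dots> = (\<Sum>s\<in>bits M. pmf (do {f \<leftarrow> Q s; err f s}) True / 2 ^ M)"
  proof (intro sum.cong refl)
    fix s assume "s \<in> bits M"
    hence "pmf (do {f \<leftarrow> Q s; err f s}) True = (\<Sum>f\<in>F. pmf (Q s) f * e f s)"
      unfolding pmf_bind e_def using F by (subst integral_measure_pmf[of F]) auto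
    thus "(\<Sum>f\<in>F. pmf (Q s) f * e f s) / 2 ^ M = pmf (do {f \<leftarrow> Q s; err f s}) True / 2 ^ M" by simp
  qed
  also have "\<dots> = pmf (do {s \<leftarrow> uniform_bits M; f \<leftarrow> Q s; err f s}) True"
    by (subst (2) pmf_bind, subst integral_pmf_of_set) (auto simp: sum_divide_distrib)
  finally show ?thesis by (simp add: \<tau>_def)
qed

section \<open>Reed-Solomon codes and the midpoint attack\<close>

text \<open>Messages list the constant coefficient first, whereas \<open>eval\<close> expects the
  leading one first; hence the reversal, and an induction that appends leading coefficients.\<close>

lemma (in ring) finsum_eq_eval_rev:
  "set m \<subseteq> carrier R \<Longrightarrow> x \<in> carrier R \<Longrightarrow>
     (\<Oplus>i\<in>{..<length m}. (m ! i) \<otimes> (x [^] i)) = eval (rev m) x"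
proof (induction m rule: rev_induct)
  case (snoc c m)
  have "(\<Oplus>i\<in>{..<length m}. ((m @ [c]) ! i) \<otimes> (x [^] i)) = (\<Oplus>i\<in>{..<length m}. (m ! i) \<otimes> (x [^] i))"
    using snoc.prems by (intro finsum_cong) (auto simp: nth_append simp_implies_def subset_iff)
  with snoc show ?case
    by (subst length_append_singleton, subst lessThan_Suc, subst finsum_insert)
      (auto simp: nth_append subset_iff Pi_iff)
qed simp

lemma (in cring) eval_map2_minus:
  "length p = length q \<Longrightarrow> set p \<subseteq> carrier R \<Longrightarrow> set q \<subseteq> carrier R \<Longrightarrow> x \<in> carrier R \<Longrightarrow>
     eval (map2 (\<lambda>a b. a \<ominus> b) p q) x = eval p x \<ominus> eval q x"
proof (induction p q rule: list_induct2)
  case (Cons a p b q)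
  have "eval p x \<in> carrier R" "eval q x \<in> carrier R" "x [^] length q \<in> carrier R"
    using Cons.prems by (auto intro: eval_in_carrier)
  moreover have "(a \<ominus> b) \<otimes> y \<oplus> (e \<ominus> f) = (a \<otimes> y \<oplus> e) \<ominus> (b \<otimes> y \<oplus> f)"
    if "y \<in> carrier R" "e \<in> carrier R" "f \<in> carrier R" for y e f
    using that Cons.prems by (simp add: a_minus_def l_distr l_minus minus_add a_ac)
  ultimately show ?case using Cons by simp
qed (simp add: a_minus_def)

lemma card_set_mset_le_size: "card (set_mset A) \<le> size A"
  by (induction A) (auto simp: card_insert_if)

text \<open>A nonzero polynomial has at most as many roots as its degree, which is below
  \<open>length p\<close>. Coefficient lists may start with zeros, so roots are counted for
  \<open>normalize p\<close>.\<close>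

lemma (in field) eval_zero_imp_coeffs_zero:
  assumes p: "set p \<subseteq> carrier R" and A: "finite A" "A \<subseteq> carrier R" "length p \<le> card A"
    and zero: "\<And>a. a \<in> A \<Longrightarrow> eval p a = \<zero>"
  shows "p = replicate (length p) \<zero>"
proof -
  let ?p = "normalize p"
  have "?p = []"
  proof (rule ccontr)
    assume ne: "?p \<noteq> []"
    have carr: "?p \<in> carrier (poly_ring R)"
      using normalize_gives_polynomial[OF p] by (simp add: univ_poly_carrier)
    have "A \<subseteq> set_mset (roots ?p)"
      using zero A ne p by (auto simp: roots_mem_iff_is_root[OF carr] is_root_def eval_normalize)
    hence "card A \<le> card (set_mset (roots ?p))" by (intro card_mono) auto
    also have "\<dots> \<le> size (roots ?p)" by (rule card_set_mset_le_size)
    also have "\<dots> \<le> degree ?p" by (rule size_roots_le_degree[OF carr])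
    also have "\<dots> < length p" using ne normalize_length_le[of p] by (cases ?p) auto
    finally show False using A by simp
  qed
  thus ?thesis using normalize_def'(1)[of p] by simp
qed

text \<open>The difference of the two message polynomials has degree below \<open>k\<close> and
  vanishes at no fewer than \<open>k\<close> distinct points.\<close>

lemma rs_encode_inj:
  assumes "field K" "distinct pts" "set pts \<subseteq> carrier K"
    and m: "length m = k" "set m \<subseteq> carrier K" and m': "length m' = k" "set m' \<subseteq> carrier K"
    and k: "k \<le> length pts"
    and eq: "rs_encode K pts m = rs_encode K pts m'"
  shows "m = m'"
proof -
  interpret field K by fact
  let ?d = "map2 (\<lambda>a b. a \<ominus>\<^bsub>K\<^esub> b) (rev m) (rev m')"
  have "?d = replicate (length ?d) \<zero>\<^bsub>K\<^esub>"
  proof (rule eval_zero_imp_coeffs_zero)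
    have "a \<in> carrier K" "b \<in> carrier K" if "(a, b) \<in> set (zip (rev m) (rev m'))" for a b
      using set_zip_leftD[OF that] set_zip_rightD[OF that] m m' by auto
    thus "set ?d \<subseteq> carrier K" by auto
    show "length ?d \<le> card (set pts)" using k m m' assms(2) by (simp add: distinct_card)
    fix a assume a: "a \<in> set pts"
    hence "eval (rev m) a = eval (rev m') a"
      using eq m m' assms(3) by (auto simp: rs_encode_def subset_iff finsum_eq_eval_rev[symmetric])
    moreover have "eval (rev m') a \<in> carrier K" using a m' assms(3) by (auto intro!: eval_in_carrier)
    ultimately show "eval ?d a = \<zero>\<^bsub>K\<^esub>"
      using a m m' assms(3) by (subst eval_map2_minus) (auto simp: a_minus_def r_neg)
  qed (use assms in auto)
  hence "\<forall>x\<in>set ?d. x = \<zero>\<^bsub>K\<^esub>" by (metis in_set_replicate)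
  hence zero: "?d ! i = \<zero>\<^bsub>K\<^esub>" if "i < k" for i
    by (rule bspec[OF _ nth_mem]) (use that m m' in simp)
  have "rev m = rev m'"
  proof (rule nth_equalityI)
    fix i assume "i < length (rev m)"
    hence i: "i < k" "rev m ! i \<in> set (rev m)" "rev m' ! i \<in> set (rev m')"
      using m m' by (auto simp del: set_rev)
    with m m' have "rev m ! i \<in> carrier K" "rev m' ! i \<in> carrier K" by (auto simp: subset_iff)
    thus "rev m ! i = rev m' ! i" using zero[OF i(1)] i(1) m m' by (simp del: rev_nth)
  qed (use m m' in simp)
  thus ?thesis by simp
qed

lemma rs_encode_words:
  assumes "ring K" "carrier K = bits l" "set pts \<subseteq> carrier K" "set m \<subseteq> carrier K"
  shows "rs_encode K pts m \<in> words l (length pts)"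
proof -
  interpret ring K by fact
  have "(\<Oplus>\<^bsub>K\<^esub>i\<in>{..<length m}. (m ! i) \<otimes>\<^bsub>K\<^esub> (a [^]\<^bsub>K\<^esub> i)) \<in> carrier K" if "a \<in> set pts" for a
    by (intro finsum_closed Pi_I m_closed nat_pow_closed) (use that assms(3,4) in auto)
  thus ?thesis by (auto simp: words_def rs_encode_def assms(2))
qed

lemma hamming_self [simp]: "hamming x x = 0" by (simp add: hamming_def)

lemma hamming_0_iff: "length x = length y \<Longrightarrow> hamming x y = 0 \<longleftrightarrow> x = y"
  by (auto simp: hamming_def intro: nth_equalityI)

text \<open>The sent message has distance 0, so a nearest codeword has distance 0 as well, and
  injectivity identifies its message. The risk evaluates \<open>target\<close> on unperturbed
  inputs, so this error-free case is the one that arises.\<close>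

lemma rs_decode_encode:
  assumes K: "field K" "carrier K = bits l" and pts: "distinct pts" "set pts \<subseteq> carrier K"
    and k: "k \<le> length pts" and m: "m \<in> words l k"
  shows "rs_decode K pts l k (rs_encode K pts m) = m"
proof -
  let ?r = "rs_decode K pts l k (rs_encode K pts m)"
  let ?h = "\<lambda>m'. hamming (rs_encode K pts m') (rs_encode K pts m)"
  have r: "?r \<in> words l k" unfolding rs_decode_def by (rule arg_min_natI, rule m)
  have "?h ?r \<le> ?h m" unfolding rs_decode_def by (rule arg_min_nat_le, rule m)
  hence "rs_encode K pts ?r = rs_encode K pts m"
    by (subst hamming_0_iff[symmetric]) (auto simp: rs_encode_def)
  thus ?thesis
    using r m K pts k by (intro rs_encode_inj[of K pts ?r k m]) (auto simp: words_def)
qed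

section \<open>Splitting bit strings into symbols, block words and their midpoints\<close>

lemma symbols_step:
  assumes "0 < l" "l \<le> length w"
  shows "symbols l w = take l w # symbols l (drop l w)"
proof -
  have "length w div l = Suc ((length w - l) div l)" using assms by (simp add: le_div_geq)
  thus ?thesis
    by (simp add: symbols_def upt_rec[of 0] map_Suc_upt[symmetric] comp_def add.commute
        del: map_Suc_upt upt_Suc)
qed

lemma symbols_concat:
  assumes "w \<in> words l n" "l > 0"
  shows "symbols l (concat w) = w"
  using assms
proof (induction w arbitrary: n)
  case (Cons a w)
  then obtain n' where "w \<in> words l n'" "length a = l"
    by (auto simp: words_def bits_def)
  thus ?case using Cons.IH \<open>l > 0\<close> by (simp add: symbols_step)
qed (simp add: symbols_def)

lemma concat_symbols: "l > 0 \<Longrightarrow> length w = k * l \<Longrightarrow> concat (symbols l w) = w"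
proof (induction k arbitrary: w)
  case (Suc k)
  thus ?case using Suc.IH[of "drop l w"] by (simp add: symbols_step)
qed (simp add: symbols_def)

lemma symbols_words: "l > 0 \<Longrightarrow> length w = k * l \<Longrightarrow> symbols l w \<in> words l k"
proof (induction k arbitrary: w)
  case (Suc k)
  thus ?case using Suc.IH[of "drop l w"] by (auto simp: symbols_step words_def bits_def)
qed (simp add: symbols_def words_def)

lemma words_append: "x \<in> words l a \<Longrightarrow> y \<in> words l b \<Longrightarrow> x @ y \<in> words l (a + b)"
  by (auto simp: words_def)

lemma length_concat_words: "w \<in> words l n \<Longrightarrow> length (concat w) = n * l"
proof (induction w arbitrary: n)
  case (Cons a w)
  thus ?case by (cases n) (auto simp: words_def bits_def)
qed (auto simp: words_def)

text \<open>Distances add over aligned blocks, so corrupting one block costs only the distance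
  within it.\<close>

lemma hamming_append:
  assumes "length x = length x'"
  shows "hamming (x @ y) (x' @ y') = hamming x x' + hamming y y'"
proof -
  have "{i. i < length (x @ y) \<and> (x @ y) ! i \<noteq> (x' @ y') ! i} =
     {i. i < length x \<and> x ! i \<noteq> x' ! i} \<union> (\<lambda>i. length x + i) ` {i. i < length y \<and> y ! i \<noteq> y' ! i}"
    (is "?L = ?A \<union> ?f ` ?B")
  proof (intro equalityI subsetI)
    fix i assume i: "i \<in> ?L"
    show "i \<in> ?A \<union> ?f ` ?B"
    proof (cases "i < length x")
      case False
      with i assms have "i - length x \<in> ?B" "i = ?f (i - length x)" by (auto simp: nth_append)
      thus ?thesis by blast
    qed (use i assms in \<open>auto simp: nth_append\<close>)
  qed (use assms in \<open>auto simp: nth_append\<close>)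
  moreover have "card (?A \<union> ?f ` ?B) = card ?A + card ?B"
    by (subst card_Un_disjoint) (auto simp: card_image)
  ultimately show ?thesis by (simp add: hamming_def)
qed

lemma hamming_le_length: "hamming x y \<le> length x"
  using card_mono[of "{..<length x}" "{i. i < length x \<and> x ! i \<noteq> y ! i}"] by (auto simp: hamming_def)

definition splice_half :: "'a list \<Rightarrow> 'a list \<Rightarrow> 'a list" where
  "splice_half x y = take (length x div 2) x @ drop (length x div 2) y"

lemma splice_half_words: "x \<in> words l n \<Longrightarrow> y \<in> words l n \<Longrightarrow> splice_half x y \<in> words l n"
  by (auto simp: words_def splice_half_def dest: in_set_takeD in_set_dropD)

text \<open>The splice differs from \<open>x\<close> only in the second half and from
  \<open>y\<close> only in the first; \<open>n - n div 2\<close> is n/2 rounded up, the longer of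
  the two.\<close>

lemma hamming_splice_half:
  assumes "length x = n" "length y = n"
  shows "hamming x (splice_half x y) \<le> n - n div 2" "hamming y (splice_half x y) \<le> n - n div 2"
proof -
  have "hamming x (splice_half x y) = hamming (drop (n div 2) x) (drop (n div 2) y)"
    using hamming_append[of "take (n div 2) x" "take (n div 2) x" "drop (n div 2) x" "drop (n div 2) y"] assms
    by (simp add: splice_half_def)
  also have "\<dots> \<le> n - n div 2" using hamming_le_length[of "drop (n div 2) x"] assms by simp
  finally show "hamming x (splice_half x y) \<le> n - n div 2" .
  have "hamming y (splice_half x y) = hamming (take (n div 2) y) (take (n div 2) x)"
    using hamming_append[of "take (n div 2) y" "take (n div 2) x" "drop (n div 2) y" "drop (n div 2) y"] assms
    by (simp add: splice_half_def)
  also have "\<dots> \<le> n div 2" using hamming_le_length[of "take (n div 2) y"] assms by simp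
  finally show "hamming y (splice_half x y) \<le> n - n div 2" by linarith
qed

lemma to_message_words:
  assumes "l > 0" "length w \<le> k * l"
  shows "to_message l k w \<in> words l k"
  unfolding to_message_def using assms by (intro symbols_words) auto

text \<open>The padding goes to the end, so the leading bit, which carries the label, stays in
  place.\<close>

lemma hd_concat_to_message:
  assumes "l > 0" "length w \<le> k * l" "w \<noteq> []"
  shows "hd (concat (to_message l k w)) = hd w"
  unfolding to_message_def using assms by (subst concat_symbols[of l _ k]) auto

section \<open>The attack at one security parameter\<close>

definition encode_input ::
  "construction \<Rightarrow> nat \<Rightarrow> bool list \<Rightarrow> bool list \<Rightarrow> bool list \<Rightarrow> bool list list \<Rightarrow> bool \<Rightarrow> bool list" where
  "encode_input P \<eta> u v vk c z = concat (ecc P \<eta> u @ ecc P \<eta> v @ ecc P \<eta> vk @ c @ ecc P \<eta> [z])"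

text \<open>The block is the same for both labels, so after the attack \<open>b\<close> enters the
  input only through the masked bit.\<close>

definition forged_block :: "construction \<Rightarrow> nat \<Rightarrow> bool list \<Rightarrow> bool list list" where
  "forged_block P \<eta> sk =
     splice_half (LEnc P \<eta> (False # Sign P sk [False])) (LEnc P \<eta> (True # Sign P sk [True]))"

text \<open>The key is drawn first, in the role of the side information \<open>k\<close> of the
  unpredictability bound; the event is an error of \<open>f\<close> on the attacked input.\<close>

definition attack_succeeds ::
  "construction \<Rightarrow> nat \<Rightarrow> (bool list \<Rightarrow> bool) \<Rightarrow> bool list \<Rightarrow> bool pmf" where
  "attack_succeeds P \<eta> f s = do {
     k \<leftarrow> Gen P \<eta>;
     u \<leftarrow> uniform_bits (seed_len P \<eta>);
     v \<leftarrow> uniform_bits (n_par P \<eta>);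
     b \<leftarrow> pmf_of_set UNIV;
     return_pmf (f (encode_input P \<eta> u v (fst k) (forged_block P \<eta> (snd k))
       (b \<noteq> inner_F2 v (nths s (samp P \<eta> u)))) \<noteq> b) }"

text \<open>Collects what the attack uses at a single \<open>\<eta>\<close>. In a valid construction
  this holds for all large \<open>\<eta>\<close>; \<open>k_le_n\<close> and
  \<open>half_le_budget\<close> are consequences of the bound on the rate.\<close>

locale attackable =
  fixes P :: construction and \<eta> :: nat
  assumes sym_len_pos: "0 < sym_len P \<eta>"
    and field_fld: "field (fld P \<eta>)" and carrier_fld: "carrier (fld P \<eta>) = bits (sym_len P \<eta>)"
    and length_points: "length (points P \<eta>) = n_par P \<eta>"
    and distinct_points: "distinct (points P \<eta>)"
    and points_carrier: "set (points P \<eta>) \<subseteq> carrier (fld P \<eta>)"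
    and k_le_n: "k_par P \<eta> \<le> n_par P \<eta>"
    and message_fits: "1 + sig_len P \<eta> \<le> k_par P \<eta> * sym_len P \<eta>"
    and half_le_budget: "real (n_par P \<eta> - n_par P \<eta> div 2) \<le> budget P \<eta>"
    and ecc_words: "\<And>m w. m \<in> {seed_len P \<eta>, n_par P \<eta>, vk_len P \<eta>, 1} \<Longrightarrow> w \<in> bits m \<Longrightarrow>
      ecc P \<eta> w \<in> words (sym_len P \<eta>) (ecc_len P \<eta> m)"
    and key_lengths: "\<And>vk sk b. (vk, sk) \<in> set_pmf (Gen P \<eta>) \<Longrightarrow>
      length vk = vk_len P \<eta> \<and> length (Sign P sk [b]) = sig_len P \<eta>"
begin

abbreviation (input) "l \<equiv> sym_len P \<eta>"

lemma signed_message_words: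
  assumes "(vk, sk) \<in> set_pmf (Gen P \<eta>)"
  shows "to_message l (k_par P \<eta>) (b # Sign P sk [b]) \<in> words l (k_par P \<eta>)"
  using message_fits key_lengths[OF assms, of b] by (intro to_message_words sym_len_pos) auto

lemma LEnc_signed_words:
  assumes "(vk, sk) \<in> set_pmf (Gen P \<eta>)"
  shows "LEnc P \<eta> (b # Sign P sk [b]) \<in> words l (n_par P \<eta>)"
  unfolding LEnc_def length_points[symmetric]
  using signed_message_words[OF assms, of b]
  by (intro rs_encode_words field_fld carrier_fld points_carrier field.is_ring)
    (auto simp: words_def carrier_fld)

lemma forged_block_words:
  assumes "(vk, sk) \<in> set_pmf (Gen P \<eta>)"
  shows "forged_block P \<eta> sk \<in> words l (n_par P \<eta>)"
  unfolding forged_block_def by (intro splice_half_words LEnc_signed_words[OF assms])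

lemma hamming_forged_block:
  assumes "(vk, sk) \<in> set_pmf (Gen P \<eta>)"
  shows "hamming (LEnc P \<eta> (b # Sign P sk [b])) (forged_block P \<eta> sk) \<le> n_par P \<eta> - n_par P \<eta> div 2"
  using LEnc_signed_words[OF assms, of True] LEnc_signed_words[OF assms, of False]
  unfolding forged_block_def words_def by (cases b) (auto intro: hamming_splice_half)

context
  fixes u v vk sk
  assumes uv: "u \<in> bits (seed_len P \<eta>)" "v \<in> bits (n_par P \<eta>)"
    and key: "(vk, sk) \<in> set_pmf (Gen P \<eta>)"
begin

lemma ecc_block_words:
  "ecc P \<eta> u \<in> words l (ecc_len P \<eta> (seed_len P \<eta>))"
  "ecc P \<eta> v \<in> words l (ecc_len P \<eta> (n_par P \<eta>))"
  "ecc P \<eta> vk \<in> words l (ecc_len P \<eta> (vk_len P \<eta>))"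
  "ecc P \<eta> [z] \<in> words l (ecc_len P \<eta> 1)"
proof -
  have "vk \<in> bits (vk_len P \<eta>)" "[z] \<in> bits 1" using key_lengths[OF key] by (auto simp: bits_def)
  with uv show "ecc P \<eta> u \<in> words l (ecc_len P \<eta> (seed_len P \<eta>))"
    "ecc P \<eta> v \<in> words l (ecc_len P \<eta> (n_par P \<eta>))"
    "ecc P \<eta> vk \<in> words l (ecc_len P \<eta> (vk_len P \<eta>))"
    "ecc P \<eta> [z] \<in> words l (ecc_len P \<eta> 1)"
    by (auto intro: ecc_words)
qed

lemma blocks_words:
  assumes "c \<in> words l (n_par P \<eta>)"
  shows "ecc P \<eta> u @ ecc P \<eta> v @ ecc P \<eta> vk @ c @ ecc P \<eta> [z] \<in> words l (num_symbols P \<eta>)"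
  unfolding num_symbols_def rs_offset_def add.assoc
  by (intro words_append ecc_block_words assms)

lemma symbols_encode_input:
  assumes "c \<in> words l (n_par P \<eta>)"
  shows "symbols l (encode_input P \<eta> u v vk c z) =
    ecc P \<eta> u @ ecc P \<eta> v @ ecc P \<eta> vk @ c @ ecc P \<eta> [z]"
  unfolding encode_input_def by (intro symbols_concat[OF blocks_words] assms sym_len_pos)

lemma encode_input_space:
  assumes "c \<in> words l (n_par P \<eta>)"
  shows "encode_input P \<eta> u v vk c z \<in> input_space P \<eta>"
  unfolding encode_input_def input_space_def bits_def
  using length_concat_words[OF blocks_words[OF assms]] by simp

text \<open>The offset skips the three codewords before the Reed-Solomon block; that block is
  intact, so decoding returns the signed message, which starts with \<open>b\<close>.\<close>

lemma target_encode_input: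
  "target P \<eta> (encode_input P \<eta> u v vk (LEnc P \<eta> (b # Sign P sk [b])) z) = b"
proof -
  let ?c = "LEnc P \<eta> (b # Sign P sk [b])"
  have c: "?c \<in> words l (n_par P \<eta>)" by (rule LEnc_signed_words[OF key])
  have "take (n_par P \<eta>) (drop (rs_offset P \<eta>) (symbols l (encode_input P \<eta> u v vk ?c z))) = ?c"
    using c ecc_block_words unfolding symbols_encode_input[OF c] rs_offset_def by (simp add: words_def)
  moreover have "rs_decode (fld P \<eta>) (points P \<eta>) l (k_par P \<eta>) ?c =
      to_message l (k_par P \<eta>) (b # Sign P sk [b])"
    unfolding LEnc_def
    using k_le_n by (intro rs_decode_encode field_fld carrier_fld distinct_points points_carrier
        signed_message_words[OF key]) (simp add: length_points)
  moreover have "hd (concat (to_message l (k_par P \<eta>) (b # Sign P sk [b]))) = b"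
    using message_fits key_lengths[OF key, of b] by (subst hd_concat_to_message) (auto simp: sym_len_pos)
  ultimately show ?thesis by (simp add: target_def encode_input_space[OF c])
qed

lemma symbol_dist_forged:
  "symbol_dist P \<eta> (encode_input P \<eta> u v vk (LEnc P \<eta> (b # Sign P sk [b])) z)
     (encode_input P \<eta> u v vk (forged_block P \<eta> sk) z) \<le> budget P \<eta>"
proof -
  have c: "LEnc P \<eta> (b # Sign P sk [b]) \<in> words l (n_par P \<eta>)" by (rule LEnc_signed_words[OF key])
  have c': "forged_block P \<eta> sk \<in> words l (n_par P \<eta>)" by (rule forged_block_words[OF key])
  have "length (LEnc P \<eta> (b # Sign P sk [b])) = length (forged_block P \<eta> sk)"
    using c c' by (simp add: words_def)
  hence "symbol_dist P \<eta> (encode_input P \<eta> u v vk (LEnc P \<eta> (b # Sign P sk [b])) z)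
     (encode_input P \<eta> u v vk (forged_block P \<eta> sk) z) =
     hamming (LEnc P \<eta> (b # Sign P sk [b])) (forged_block P \<eta> sk)"
    unfolding symbol_dist_def symbols_encode_input[OF c] symbols_encode_input[OF c']
    by (simp add: hamming_append)
  also have "\<dots> \<le> real (n_par P \<eta> - n_par P \<eta> div 2)"
    using hamming_forged_block[OF key, of b] by simp
  finally show ?thesis using half_le_budget by linarith
qed

end

text \<open>Drawing the key first matches \<open>attack_succeeds\<close> draw by draw, so that
  honest and attacked inputs can be coupled.\<close>

lemma input_dist_alt:
  "input_dist P \<eta> s = do {
     k \<leftarrow> Gen P \<eta>;
     u \<leftarrow> uniform_bits (seed_len P \<eta>);
     v \<leftarrow> uniform_bits (n_par P \<eta>);
     b \<leftarrow> pmf_of_set UNIV;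
     return_pmf (encode_input P \<eta> u v (fst k) (LEnc P \<eta> (b # Sign P (snd k) [b]))
       (b \<noteq> inner_F2 v (nths s (samp P \<eta> u)))) }"
  unfolding input_dist_def encode_input_def case_prod_unfold
  by (subst bind_commute_pmf[of "Gen P \<eta>" "uniform_bits (seed_len P \<eta>)"],
      subst bind_commute_pmf[of "Gen P \<eta>" "uniform_bits (n_par P \<eta>)"],
      subst bind_commute_pmf[of "Gen P \<eta>" "pmf_of_set UNIV"]) (rule refl)

lemma set_input_dist: "set_pmf (input_dist P \<eta> s) \<subseteq> input_space P \<eta>"
  unfolding input_dist_alt by (auto intro!: encode_input_space LEnc_signed_words)

text \<open>Under shared randomness the attacked input lies within the budget of the honest one,
  whose label is \<open>b\<close>; it is thus a witness for the risk whenever \<open>f\<close> errs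
  on it.\<close>

lemma attack_succeeds_le_risk:
  "pmf (attack_succeeds P \<eta> f s) True \<le>
     risk (learning_problem P \<eta>) (symbol_dist P \<eta>) (budget P \<eta>) (target P \<eta>) (input_dist P \<eta> s) f"
proof -
  let ?bad = "\<lambda>x. \<exists>x'\<in>input_space P \<eta>. f x' \<noteq> target P \<eta> x \<and> symbol_dist P \<eta> x x' \<le> budget P \<eta>"
  have "pmf (attack_succeeds P \<eta> f s) True \<le>
     pmf (do {
     k \<leftarrow> Gen P \<eta>;
     u \<leftarrow> uniform_bits (seed_len P \<eta>);
     v \<leftarrow> uniform_bits (n_par P \<eta>);
     b \<leftarrow> pmf_of_set UNIV;
     return_pmf (?bad (encode_input P \<eta> u v (fst k) (LEnc P \<eta> (b # Sign P (snd k) [b]))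
       (b \<noteq> inner_F2 v (nths s (samp P \<eta> u))))) }) True + 0"
    unfolding attack_succeeds_def
  proof (intro pmf_bind_mono)
    fix k u v and b :: bool
    assume "k \<in> set_pmf (Gen P \<eta>)" "u \<in> set_pmf (uniform_bits (seed_len P \<eta>))"
      "v \<in> set_pmf (uniform_bits (n_par P \<eta>))"
    hence k: "(fst k, snd k) \<in> set_pmf (Gen P \<eta>)"
      and uv: "u \<in> bits (seed_len P \<eta>)" "v \<in> bits (n_par P \<eta>)" by auto
    let ?z = "b \<noteq> inner_F2 v (nths s (samp P \<eta> u))"
    let ?x' = "encode_input P \<eta> u v (fst k) (forged_block P \<eta> (snd k)) ?z"
    let ?x = "encode_input P \<eta> u v (fst k) (LEnc P \<eta> (b # Sign P (snd k) [b])) ?z"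
    have "?bad ?x" if "f ?x' \<noteq> b"
      using that encode_input_space[OF uv k forged_block_words[OF k]] symbol_dist_forged[OF uv k]
        target_encode_input[OF uv k] by blast
    thus "pmf (return_pmf (f ?x' \<noteq> b)) True \<le> pmf (return_pmf (?bad ?x)) True + 0"
      by (cases "f ?x' \<noteq> b") auto
  qed
  also have "\<dots> = pmf (do {x \<leftarrow> input_dist P \<eta> s; return_pmf (?bad x)}) True"
    unfolding input_dist_alt bind_assoc_pmf bind_return_pmf by simp
  also have "\<dots> = risk (learning_problem P \<eta>) (symbol_dist P \<eta>) (budget P \<eta>) (target P \<eta>) (input_dist P \<eta> s) f"
    unfolding pmf_bind_return_True risk_def by (simp add: learning_problem_def)
  finally show ?thesis .
qed

lemma attack_le_expected_risk:
  "pmf (do {S \<leftarrow> replicate_pmf N (input_dist P \<eta> s); f \<leftarrow> L (labelled (target P \<eta>) S) \<eta>;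
       attack_succeeds P \<eta> f s}) True \<le>
   expected_risk (learning_problem P \<eta>) (symbol_dist P \<eta>) (budget P \<eta>) L \<eta> (target P \<eta>) (input_dist P \<eta> s) N"
  unfolding expected_risk_def bind_assoc_pmf[symmetric] pmf_bind[of _ "\<lambda>f. attack_succeeds P \<eta> f s"]
  by (intro integral_mono_AE measure_pmf.integrable_const_bound[of _ 1] AE_I2 attack_succeeds_le_risk)
    (auto simp: pmf_le_1 risk_def)

text \<open>A bound for every secret also bounds the average over a uniform secret. To this average
  the conditioning argument applies, with sampling and learning together as the channel from secret
  to model.\<close>

lemma average_expected_risk_ge:
  fixes \<delta> \<theta> :: real
  assumes samp: "is_sampler \<kappa> \<delta> (alpha P \<eta>) (n_par P \<eta>) (seed_len P \<eta>) (samp P \<eta>)"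
    and F: "finite (models (learning_problem P) L \<eta>)"
    and c: "0 \<le> c" "c \<le> 1 / 2 - 2 powr (- ((\<theta> - \<kappa>) * real (n_par P \<eta>)) / 2) / 2 - \<delta>"
    and risk: "\<And>s. s \<in> bits (alpha P \<eta>) \<Longrightarrow>
      expected_risk (learning_problem P \<eta>) (symbol_dist P \<eta>) (budget P \<eta>) L \<eta> (target P \<eta>)
        (input_dist P \<eta> s) N \<le> \<epsilon>"
  shows "c * (1 - real (card (models (learning_problem P) L \<eta>)) *
    2 powr (- ((1 - \<theta>) * real (alpha P \<eta>)))) \<le> \<epsilon>"
proof -
  let ?Q = "\<lambda>s. do {S \<leftarrow> replicate_pmf N (input_dist P \<eta> s); L (labelled (target P \<eta>) S) \<eta>}"
  have "c * (1 - real (card (models (learning_problem P) L \<eta>)) *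
      2 powr (- ((1 - \<theta>) * real (alpha P \<eta>)))) \<le>
    pmf (do {s \<leftarrow> uniform_bits (alpha P \<eta>); f \<leftarrow> ?Q s; attack_succeeds P \<eta> f s}) True"
  proof (rule short_model_lower_bound[OF F _ c(1)])
    fix s
    show "set_pmf (?Q s) \<subseteq> models (learning_problem P) L \<eta>"
      using set_input_dist[of s] by (fastforce simp: models_def learning_problem_def set_replicate_pmf)
  next
    fix f Z
    assume "set_pmf Z \<subseteq> bits (alpha P \<eta>)" "\<theta> * real (alpha P \<eta>) \<le> min_entropy Z"
    \<comment> \<open>A fixed model becomes a predictor of \<open>b\<close>: from key,
      \<open>u\<close>, \<open>v\<close> and the masked bit \<open>z\<close> one builds the attacked
      input and applies \<open>f\<close>.\<close>
    from sampled_inner_product_unpredictable[OF samp this, of "Gen P \<eta>"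
        "\<lambda>k u v z. f (encode_input P \<eta> u v (fst k) (forged_block P \<eta> (snd k)) z)"] c(2)
    show "c \<le> pmf (do {s \<leftarrow> Z; attack_succeeds P \<eta> f s}) True"
      unfolding attack_succeeds_def by linarith
  qed
  also have "\<dots> \<le> \<epsilon>"
  proof (rule pmf_bind_le)
    fix s assume "s \<in> set_pmf (uniform_bits (alpha P \<eta>))"
    hence "s \<in> bits (alpha P \<eta>)" by simp
    from order_trans[OF attack_le_expected_risk risk[OF this]]
    show "pmf (do {f \<leftarrow> ?Q s; attack_succeeds P \<eta> f s}) True \<le> \<epsilon>"
      by (simp add: bind_assoc_pmf)
  qed
  finally show ?thesis .
qed

end

section \<open>Asymptotics of the parameters and the choice of constants\<close>

lemma polynomial_size_at_top:
  assumes "polynomial_size f"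
  shows "filterlim (\<lambda>\<eta>. real (f \<eta>)) at_top sequentially"
proof -
  obtain a b where "a > 0" and ev: "\<forall>\<^sub>F \<eta> in sequentially. real \<eta> powr a \<le> real (f \<eta>) \<and> real (f \<eta>) \<le> real \<eta> powr b"
    using assms unfolding polynomial_size_def by blast
  have "filterlim (\<lambda>\<eta>. real \<eta> powr a) at_top sequentially" using \<open>a > 0\<close> by real_asymp
  thus ?thesis by (rule filterlim_at_top_mono) (use ev in \<open>auto elim: eventually_mono\<close>)
qed

text \<open>Since \<open>rate P < 1 / 4\<close>, the budget exceeds n/2 by a fixed fraction of n,
  which eventually absorbs the rounding of n/2.\<close>

lemma valid_construction_attackable:
  assumes "valid_construction \<kappa> P"
  shows "\<forall>\<^sub>F \<eta> in sequentially. attackable P \<eta>"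
proof -
  let ?R = "rate P"
  have R: "0 < ?R" "?R < 1 / 4" using assms by (auto simp: valid_construction_def)
  have sqrtR: "sqrt ?R < 1 / 2" using real_sqrt_less_mono[OF R(2)] by (simp add: real_sqrt_divide)
  have n: "filterlim (\<lambda>\<eta>. real (n_par P \<eta>)) at_top sequentially"
    using assms by (intro polynomial_size_at_top) (auto simp: valid_construction_def)
  have theta: "(\<lambda>\<eta>. real (sym_len P \<eta>)) \<in> \<Theta>(\<lambda>\<eta>. ln (real \<eta>))"
    using assms by (auto simp: valid_construction_def)
  have "\<forall>\<^sub>F \<eta> in sequentially. ln (real \<eta>) \<noteq> 0"
    using eventually_gt_at_top[of 1] by eventually_elim simp
  hence l: "\<forall>\<^sub>F \<eta> in sequentially. real (sym_len P \<eta>) \<noteq> 0"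
    using eventually_nonzero_bigtheta[OF theta] by simp
  \<comment> \<open>Rounding n/2 up costs at most 1/2, so \<open>(1 / 2 - sqrt (rate P)) * n\<close>
    has to reach 1/2.\<close>
  have half: "\<forall>\<^sub>F \<eta> in sequentially. 1 / 2 / (1 / 2 - sqrt ?R) \<le> real (n_par P \<eta>)"
    using n unfolding filterlim_at_top by blast
  have fld: "\<forall>\<^sub>F \<eta> in sequentially.
        field (fld P \<eta>) \<and> carrier (fld P \<eta>) = bits (sym_len P \<eta>) \<and>
        length (points P \<eta>) = n_par P \<eta> \<and> distinct (points P \<eta>) \<and>
        set (points P \<eta>) \<subseteq> carrier (fld P \<eta>)"
    and ecc: "\<forall>\<^sub>F \<eta> in sequentially. \<forall>m\<in>{seed_len P \<eta>, n_par P \<eta>, vk_len P \<eta>, 1}.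
        corrects_more_than (budget P \<eta>) (sym_len P \<eta>) m (ecc_len P \<eta> m) (ecc P \<eta>)"
    and keys: "\<forall>\<^sub>F \<eta> in sequentially.
        (\<forall>(vk, sk)\<in>set_pmf (Gen P \<eta>).
           length vk = vk_len P \<eta> \<and> (\<forall>b. length (Sign P sk [b]) = sig_len P \<eta>)) \<and>
        1 + sig_len P \<eta> \<le> k_par P \<eta> * sym_len P \<eta>"
    using assms unfolding valid_construction_def by blast+
  show ?thesis
    using l half fld ecc keys
  proof eventually_elim
    case (elim \<eta>)
    have "real_of_int \<lfloor>?R * real (n_par P \<eta>)\<rfloor> \<le> ?R * real (n_par P \<eta>)" by linarith
    also have "\<dots> \<le> 1 * real (n_par P \<eta>)" using R by (intro mult_right_mono) auto
    finally have k: "k_par P \<eta> \<le> n_par P \<eta>" unfolding k_par_def by linarith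
    have "1 / 2 \<le> (1 / 2 - sqrt ?R) * real (n_par P \<eta>)"
      using elim(2) sqrtR by (simp add: field_simps)
    moreover have "real (n_par P \<eta> - n_par P \<eta> div 2) \<le> real (n_par P \<eta>) / 2 + 1 / 2" by linarith
    ultimately have half: "real (n_par P \<eta> - n_par P \<eta> div 2) \<le> budget P \<eta>"
      by (simp add: budget_def algebra_simps)
    have pos: "0 < sym_len P \<eta>" using elim(1) by simp
    show ?case
    proof (rule attackable.intro)
      show "ecc P \<eta> w \<in> words (sym_len P \<eta>) (ecc_len P \<eta> m)"
        if "m \<in> {seed_len P \<eta>, n_par P \<eta>, vk_len P \<eta>, 1}" "w \<in> bits m" for m w
        using elim(4) that unfolding corrects_more_than_def by blast
      show "length vk = vk_len P \<eta> \<and> length (Sign P sk [b]) = sig_len P \<eta>"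
        if "(vk, sk) \<in> set_pmf (Gen P \<eta>)" for vk sk b
        using elim(5) that by fast
    qed (use pos elim(3,5) k half in blast)+
  qed
qed

text \<open>Both exponents diverge: \<open>\<alpha>\<close> exceeds \<open>\<eta>\<close> and
  \<open>kappa1\<close> is at least a constant over \<open>ln \<eta>\<close>, so their product
  outgrows a multiple of \<open>\<eta> / ln \<eta>\<close>; the other exponent is at least
  \<open>\<eta> powr kappa2 P\<close>.\<close>

lemma sampler_error_tendsto_0:
  assumes "valid_construction \<kappa> P" "c > 0"
  shows "(\<lambda>\<eta>. exp (- c * real (alpha P \<eta>) * kappa1 P \<eta>) + exp (- (real (alpha P \<eta>) powr kappa2 P)))
    \<longlonglongrightarrow> 0"
proof -
  have alpha: "\<forall>\<^sub>F \<eta> in sequentially. \<eta> < alpha P \<eta>"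
    and k1: "\<forall>\<^sub>F \<eta> in sequentially. 0 < kappa1 P \<eta>"
    using assms(1) unfolding valid_construction_def eventually_conj_iff by blast+
  have k2: "kappa2 P > 0" and "kappa1 P \<in> \<Omega>(\<lambda>\<eta>. 1 / ln (real \<eta>))"
    using assms(1) by (auto simp: valid_construction_def)
  then obtain C where C: "C > 0"
    "\<forall>\<^sub>F \<eta> in sequentially. norm (kappa1 P \<eta>) \<ge> C * norm (1 / ln (real \<eta>))"
    by (auto elim: landau_omega.bigE)
  have "filterlim (\<lambda>\<eta>. c * real \<eta> * (C * \<bar>1 / ln (real \<eta>)\<bar>)) at_top sequentially"
    using C(1) assms(2) by real_asymp
  hence "filterlim (\<lambda>\<eta>. c * real (alpha P \<eta>) * kappa1 P \<eta>) at_top sequentially"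
  proof (rule filterlim_at_top_mono)
    show "\<forall>\<^sub>F \<eta> in sequentially. c * real \<eta> * (C * \<bar>1 / ln (real \<eta>)\<bar>) \<le> c * real (alpha P \<eta>) * kappa1 P \<eta>"
      using alpha k1 C(2)
    proof eventually_elim
      case (elim \<eta>)
      thus ?case using assms(2) C(1) by (intro mult_mono) auto
    qed
  qed
  moreover have "filterlim (\<lambda>\<eta>. real \<eta> powr kappa2 P) at_top sequentially"
    using k2 by real_asymp
  hence "filterlim (\<lambda>\<eta>. real (alpha P \<eta>) powr kappa2 P) at_top sequentially"
  proof (rule filterlim_at_top_mono)
    show "\<forall>\<^sub>F \<eta> in sequentially. real \<eta> powr kappa2 P \<le> real (alpha P \<eta>) powr kappa2 P"
      using alpha k2 by (auto elim!: eventually_mono intro!: powr_mono2)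
  qed
  moreover have "((\<lambda>x. exp (- x)) \<longlongrightarrow> (0::real)) at_top" by real_asymp
  ultimately have "(\<lambda>\<eta>. exp (- (c * real (alpha P \<eta>) * kappa1 P \<eta>)) +
      exp (- (real (alpha P \<eta>) powr kappa2 P))) \<longlonglongrightarrow> 0 + 0"
    by (intro tendsto_add) (auto intro: filterlim_compose)
  thus ?thesis by simp
qed

theorem theorem29:
  shows "\<exists>\<kappa>>0. \<forall>(P :: construction) (L :: (bool list, bool) learner) (\<epsilon> :: nat \<Rightarrow> nat \<Rightarrow> real).
    valid_construction \<kappa> P \<longrightarrow>
    learner_for (learning_problem P) L \<longrightarrow>
    param_bits_le (learning_problem P) L (\<lambda>\<eta>. real (alpha P \<eta>) / 2) \<longrightarrow>
    (\<exists>\<^sub>F \<eta> in sequentially. \<exists>N. \<epsilon> \<eta> N < 1 / 3) \<longrightarrow>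
    \<not> robustly_learns (learning_problem P) (symbol_dist P) (budget P) \<epsilon> L"
\<comment> \<open>The constants fit with entropy rate 3/8 for the conditioned secret: it lies below
  the 1/2 left by the model, so rare models are negligible, and a sampler loss of 1/8 still leaves
  rate 1/4.\<close>
proof (intro exI[of _ "1 / 8"] conjI allI impI notI)
  fix P :: construction and L :: "(bool list, bool) learner" and \<epsilon> :: "nat \<Rightarrow> nat \<Rightarrow> real"
  assume valid: "valid_construction (1 / 8) P"
    and params: "param_bits_le (learning_problem P) L (\<lambda>\<eta>. real (alpha P \<eta>) / 2)"
    and freq: "\<exists>\<^sub>F \<eta> in sequentially. \<exists>N. \<epsilon> \<eta> N < 1 / 3"
    and learns: "robustly_learns (learning_problem P) (symbol_dist P) (budget P) \<epsilon> L"
  obtain c where "c > 0" and samp: "\<forall>\<^sub>F \<eta> in sequentially.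
        is_sampler (kappa1 P \<eta>)
          (exp (- c * real (alpha P \<eta>) * kappa1 P \<eta>) + exp (- (real (alpha P \<eta>) powr kappa2 P)))
          (alpha P \<eta>) (n_par P \<eta>) (seed_len P \<eta>) (samp P \<eta>)"
    using valid unfolding valid_construction_def by blast
  define \<delta> where "\<delta> \<eta> =
    exp (- c * real (alpha P \<eta>) * kappa1 P \<eta>) + exp (- (real (alpha P \<eta>) powr kappa2 P))" for \<eta>
  \<comment> \<open>Rate 1/4 makes the average bias at most \<open>2 powr (- (n / 8))\<close>;
    \<open>q\<close> is the resulting error bound with the sampler error deducted.\<close>
  define q where "q \<eta> = 1 / 2 - 2 powr (- (real (n_par P \<eta>) / 8)) / 2 - \<delta> \<eta>" for \<eta>
  have k1: "\<forall>\<^sub>F \<eta> in sequentially. kappa1 P \<eta> \<le> 1 / 8"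
    using valid unfolding valid_construction_def eventually_conj_iff by blast
  have n: "filterlim (\<lambda>\<eta>. real (n_par P \<eta>)) at_top sequentially"
    and alpha: "filterlim (\<lambda>\<eta>. real (alpha P \<eta>)) at_top sequentially"
    using valid by (auto simp: valid_construction_def intro: polynomial_size_at_top)
  have decay: "((\<lambda>x::real. 2 powr (- (x / 8))) \<longlongrightarrow> (0 :: real)) at_top" by real_asymp
  have "\<delta> \<longlonglongrightarrow> 0"
    unfolding \<delta>_def by (rule sampler_error_tendsto_0[OF valid \<open>c > 0\<close>])
  hence q: "q \<longlonglongrightarrow> 1 / 2 - 0 / 2 - 0"
    unfolding q_def by (intro tendsto_intros filterlim_compose[OF decay n]) simp_all
  hence "(\<lambda>\<eta>. q \<eta> * (1 - 2 powr (- (real (alpha P \<eta>) / 8)))) \<longlonglongrightarrow> (1 / 2 - 0 / 2 - 0) * (1 - 0)"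
    by (intro tendsto_intros filterlim_compose[OF decay alpha])
  \<comment> \<open>The limit is 1/2, strictly above 1/3.\<close>
  hence large: "\<forall>\<^sub>F \<eta> in sequentially. q \<eta> * (1 - 2 powr (- (real (alpha P \<eta>) / 8))) > 1 / 3"
    by (rule order_tendstoD) simp
  have q_pos: "\<forall>\<^sub>F \<eta> in sequentially. q \<eta> > 0" using q by (rule order_tendstoD) simp
  have "\<forall>\<^sub>F \<eta> in sequentially. \<forall>N. \<epsilon> \<eta> N \<ge> 1 / 3"
    using samp k1 large q_pos valid_construction_attackable[OF valid]
  proof eventually_elim
    case (elim \<eta>)
    interpret attackable P \<eta> by (rule elim(5))
    let ?F = "models (learning_problem P) L \<eta>"
    show ?case
    proof
      fix N
      have "2 powr (- ((3 / 8 - kappa1 P \<eta>) * real (n_par P \<eta>)) / 2) \<le>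
          (2 :: real) powr (- (real (n_par P \<eta>) / 8))"
        using mult_right_mono[OF elim(2), of "real (n_par P \<eta>)"]
        by (intro powr_mono) (auto simp: algebra_simps)
      hence q_le: "q \<eta> \<le> 1 / 2 - 2 powr (- ((3 / 8 - kappa1 P \<eta>) * real (n_par P \<eta>)) / 2) / 2 - \<delta> \<eta>"
        by (simp add: q_def)
      \<comment> \<open>There are at most \<open>2 powr (\<alpha> / 2)\<close> models, each
        discarded below \<open>2 powr (- (5 / 8) * \<alpha>)\<close>, so the lost mass is at most
        \<open>2 powr (- (\<alpha> / 8))\<close>.\<close>
      have "real (card ?F) * 2 powr (- ((1 - 3 / 8) * real (alpha P \<eta>))) \<le>
          2 powr (real (alpha P \<eta>) / 2) * 2 powr (- ((1 - 3 / 8) * real (alpha P \<eta>)))"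
        using params by (intro mult_right_mono) (auto simp: param_bits_le_def)
      also have "\<dots> = 2 powr (- (real (alpha P \<eta>) / 8))"
        by (simp add: powr_add[symmetric])
      finally have "q \<eta> * (1 - 2 powr (- (real (alpha P \<eta>) / 8))) \<le>
          q \<eta> * (1 - real (card ?F) * 2 powr (- ((1 - 3 / 8) * real (alpha P \<eta>))))"
        using elim(4) by (intro mult_left_mono) auto
      also have "\<dots> \<le> \<epsilon> \<eta> N"
      proof (rule average_expected_risk_ge)
        show "is_sampler (kappa1 P \<eta>) (\<delta> \<eta>) (alpha P \<eta>) (n_par P \<eta>) (seed_len P \<eta>) (samp P \<eta>)"
          using elim(1) by (simp only: \<delta>_def)
        show "finite ?F" using params by (simp add: param_bits_le_def)
        fix s assume "s \<in> bits (alpha P \<eta>)"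
        hence "input_dist P \<eta> s \<in> dists (learning_problem P \<eta>)"
          by (auto simp: learning_problem_def)
        moreover have "target P \<eta> \<in> hyps (learning_problem P \<eta>)" by (simp add: learning_problem_def)
        ultimately show "expected_risk (learning_problem P \<eta>) (symbol_dist P \<eta>) (budget P \<eta>) L \<eta>
            (target P \<eta>) (input_dist P \<eta> s) N \<le> \<epsilon> \<eta> N"
          using learns unfolding robustly_learns_def by blast
      qed (use elim(4) q_le in auto)
      finally show "\<epsilon> \<eta> N \<ge> 1 / 3" using elim(3) by linarith
    qed
  qed
  \<comment> \<open>The lower bound holds for every sample size at all large \<open>\<eta>\<close>,
    while \<open>freq\<close> provides arbitrarily large \<open>\<eta>\<close> violating it for some
    \<open>N\<close>.\<close>
  with freq show False
    by (auto simp: frequently_def not_less elim: eventually_mono)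
qed simp

end
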